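(* Every tetrahedral chain contains at most $3$ zigzags up to reversing. Moreover, for $k\in\{1,2,3\}$ and $n\geq 1$ let $p^{(k)}_n$ be the probability that the random step-by-step construction (described in the context) produces a tetrahedral chain $\Theta_n$ of length $n$ with precisely $k$ zigzags up to reversing. Then (1) $\displaystyle\lim_{n\to\infty}p^{(1)}_n=\frac{8}{15}$, (2) $\displaystyle\lim_{n\to\infty}p^{(2)}_n=\frac{2}{5}$, (3) $\displaystyle\lim_{n\to\infty}p^{(3)}_n=\frac{1}{15}$, and these three sequences of probabilities converge at an exponential rate (i.e., writing $L_k=\lim_{n\to\infty}p^{(k)}_n$, for each $k$ there are constants $c>0$ and $\gamma\in(0,1)$ with $|p^{(k)}_n-L_k|\leq c\gamma^n$ for all $n$).
   Context: Triangulations. A triangulation $\Gamma$ of a connected closed $2$-dimensional surface $M$ (not necessarily orientable) is a $2$-cell embedding of a connected simple finite graph in $M$ all of whose faces are triangles, such that every edge is contained in precisely two distinct faces and the intersection of two distinct faces is an edge, a vertex, or empty. Two distinct edges are adjacent if some face contains both of them (they then share a vertex). Zigzags. A zigzag in $\Gamma$ is a sequence of (non-oriented) edges $\{e_i\}_{i\in\mathbb{N}}$ such that for every $i$: $e_i,e_{i+1}$ are adjacent; the faces containing $e_i,e_{i+1}$ and $e_{i+1},e_{i+2}$ are distinct; and $e_i,e_{i+2}$ are disjoint. As $\Gamma$ is finite, each zigzag is periodic and is regarded as a cyclic sequence $e_1,\dots,e_n$ (up to cyclic shift), where $n$ is the smallest period. Any ordered pair of distinct edges of a face, taken as consecutive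 edges, determines a unique zigzag. The reverse of $Z=\{e_1,\dots,e_n\}$ is the zigzag $Z^{-1}=\{e_n,\dots,e_1\}$; always $Z\neq Z^{-1}$. $\mathcal{Z}(\Gamma)$ is the set of all zigzags of $\Gamma$; if $|\mathcal{Z}(\Gamma)|=2k$ then $\Gamma$ is said to contain precisely $k$ zigzags up to reversing. Connected sums. Let $\Gamma,\Gamma'$ be triangulations of surfaces $M,M'$ with faces $F$ of $\Gamma$ and $F'$ of $\Gamma'$. A homeomorphism $g:\partial F\to\partial F'$ sending vertices to vertices is called special. The connected sum $\Gamma\#_g\Gamma'$ is the graph embedded in $M\#M'$ obtained by removing the interiors of $F$ and $F'$ and identifying each vertex $v$ of $F$ with $g(v)$ and each edge $vw$ of $F$ with $g(v)g(w)$. Its faces are all faces of $\Gamma$ and $\Gamma'$ other than $F,F'$. Tetrahedral chains. A tetrahedron is the embedding of $K_4$ in the sphere $\mathbb{S}^2$ with its four triangular faces. Let $T^{(1)},\dots,T^{(n)}$ be tetrahedra, where $T^{(i)}$ has faces $F^{(i)}_1,\dots,F^{(i)}_4$. Let $g_i:\partial F^{(i)}_{p_i}\to\partial F^{(i+1)}_{q_i}$ ($i=1,\dots,n-1$, $p_i,q_i\in\{1,2,3,4\}$) be special homeomorphisms with $q_i\neq p_{i+1}$ for $i=1,\dots,n-2$. Put $\Theta_1=T^{(1)}$ and $\Theta_k=\Theta_{k-1}\#_{g_{k-1}}T^{(k)}$ for $k=2,\dots,n$. Each $\Theta_k$ is called a (combinatorial) tetrahedral chain of length $k$; it is a triangulation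 of $\mathbb{S}^2$. In other words, each new tetrahedron is glued to one of the faces of the chain that come from the tetrahedron attached in the previous step. Random construction. Start with a tetrahedron $\Theta_1$; choose one of its four faces uniformly at random (probability $\frac14$ each) and glue a tetrahedron to it, obtaining $\Theta_2$. In each subsequent step choose uniformly at random (probability $\frac13$ each, independently of the previous choices) one of the three faces that come from the tetrahedron attached in the previous step, and glue a new tetrahedron to it. The result after $n$ tetrahedra have been used is $\Theta_n$. (Probabilities are with respect to this construction, not the uniform distribution over isomorphism classes of chains.) *)

theory Defs
  imports "HOL-Probability.Probability_Mass_Function"
begin

text \<open>
  A triangulation is represented by the set of its faces, each face being the set of its three
  vertices.  This loses nothing: two distinct faces meet in at most an edge, so a face is determined
  by its vertices; every edge lies on a face; and the graph is simple, so an edge is a two-element set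
  of vertices.  A triangle of the graph that bounds no face (such as the one along which two
  triangulations have been glued) is simply not a member of the set.
\<close>

definition edges :: "'a set set \<Rightarrow> 'a set set" where
  "edges \<Gamma> = {e. card e = 2 \<and> (\<exists>F\<in>\<Gamma>. e \<subseteq> F)}"

definition adjacent :: "'a set set \<Rightarrow> 'a set \<Rightarrow> 'a set \<Rightarrow> bool" where
  "adjacent \<Gamma> e e' \<longleftrightarrow> e \<in> edges \<Gamma> \<and> e' \<in> edges \<Gamma> \<and> e \<noteq> e' \<and> (\<exists>F\<in>\<Gamma>. e \<subseteq> F \<and> e' \<subseteq> F)"

definition zigzag :: "'a set set \<Rightarrow> (nat \<Rightarrow> 'a set) \<Rightarrow> bool" where
  "zigzag \<Gamma> e \<longleftrightarrow>
     (\<forall>i. adjacent \<Gamma> (e i) (e (i + 1)) \<and>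
          (\<forall>F\<in>\<Gamma>. \<forall>F'\<in>\<Gamma>. e i \<union> e (i + 1) \<subseteq> F \<and> e (i + 1) \<union> e (i + 2) \<subseteq> F' \<longrightarrow> F \<noteq> F') \<and>
          e i \<inter> e (i + 2) = {})"

text \<open>
  Zigzags are periodic, so a cyclic sequence up to cyclic shift is the set of all shifts of the
  corresponding periodic infinite sequence.
\<close>

definition cyclic_sequence :: "(nat \<Rightarrow> 'b) \<Rightarrow> (nat \<Rightarrow> 'b) set" where
  "cyclic_sequence e = range (\<lambda>k i. e (i + k))"

definition zigzags :: "'a set set \<Rightarrow> (nat \<Rightarrow> 'a set) set set" where
  "zigzags \<Gamma> = cyclic_sequence ` {e. zigzag \<Gamma> e}"

text \<open>
  No zigzag equals its reverse, so having \<open>k\<close> zigzags up to reversing means having \<open>2 k\<close> zigzags.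
\<close>

definition has_zigzags_up_to_reversing :: "'a set set \<Rightarrow> nat \<Rightarrow> bool" where
  "has_zigzags_up_to_reversing \<Gamma> k \<longleftrightarrow> finite (zigzags \<Gamma>) \<and> card (zigzags \<Gamma>) = 2 * k"

definition tetrahedron :: "'a set set \<Rightarrow> bool" where
  "tetrahedron T \<longleftrightarrow> (\<exists>V. card V = 4 \<and> T = {F. F \<subseteq> V \<and> card F = 3})"

text \<open>
  A special homeomorphism of face boundaries is given by a bijection \<open>g\<close> between the vertex sets of
  the faces.  Each vertex \<open>v\<close> of \<open>F\<close> is identified with \<open>g v\<close>, and the merged vertex keeps the name
  \<open>g v\<close>; hence the faces of the second summand are literally faces of the connected sum.  The two
  summands are meant to have disjoint vertex sets.
\<close>

definition connected_sum ::
  "'a set set \<Rightarrow> 'a set \<Rightarrow> ('a \<Rightarrow> 'a) \<Rightarrow> 'a set set \<Rightarrow> 'a set \<Rightarrow> 'a set set" where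
  "connected_sum \<Gamma> F g \<Gamma>' F' =
     (\<lambda>G. (\<lambda>v. if v \<in> F then g v else v) ` G) ` (\<Gamma> - {F}) \<union> (\<Gamma>' - {F'})"

definition tetrahedron_gluing ::
  "'a set set \<Rightarrow> 'a set \<Rightarrow> 'a set set \<times> 'a set \<times> ('a \<Rightarrow> 'a) \<Rightarrow> bool" where
  "tetrahedron_gluing \<Theta> F = (\<lambda>(T, F', g).
     tetrahedron T \<and> \<Union>\<Theta> \<inter> \<Union>T = {} \<and> F' \<in> T \<and> bij_betw g F F')"

text \<open>
  \<open>chain_state n \<Theta> A\<close>: \<open>\<Theta>\<close> is a tetrahedral chain of length \<open>n\<close>, and \<open>A\<close> is the set of those faces of
  \<open>\<Theta>\<close> that come from the last tetrahedron: all four of them if \<open>n = 1\<close>, and otherwise the three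
  not used for attaching it.
\<close>

inductive chain_state :: "nat \<Rightarrow> 'a set set \<Rightarrow> 'a set set \<Rightarrow> bool" where
  start: "tetrahedron T \<Longrightarrow> chain_state 1 T T"
| step: "chain_state n \<Theta> A \<Longrightarrow> F \<in> A \<Longrightarrow> tetrahedron_gluing \<Theta> F (T, F', g) \<Longrightarrow>
    chain_state (n + 1) (connected_sum \<Theta> F g T F') (T - {F'})"

definition tetrahedral_chain :: "nat \<Rightarrow> 'a set set \<Rightarrow> bool" where
  "tetrahedral_chain n \<Theta> \<longleftrightarrow> (\<exists>A. chain_state n \<Theta> A)"

text \<open>
  In the random construction only the face of the chain is random.  Which copy of the tetrahedron is
  glued to it, by which of its faces and by which special homeomorphism, is left open; these choices
  are made by an arbitrary rule \<open>R\<close>.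
\<close>

definition gluing_rule ::
  "('a set set \<Rightarrow> 'a set \<Rightarrow> 'a set set \<times> 'a set \<times> ('a \<Rightarrow> 'a)) \<Rightarrow> bool" where
  "gluing_rule R \<longleftrightarrow>
     (\<forall>n \<Theta> A F. chain_state n \<Theta> A \<and> F \<in> A \<longrightarrow> tetrahedron_gluing \<Theta> F (R \<Theta> F))"

definition glue_random ::
  "('a set set \<Rightarrow> 'a set \<Rightarrow> 'a set set \<times> 'a set \<times> ('a \<Rightarrow> 'a)) \<Rightarrow>
   'a set set \<times> 'a set set \<Rightarrow> ('a set set \<times> 'a set set) pmf" where
  "glue_random R = (\<lambda>(\<Theta>, A).
     map_pmf (\<lambda>F. case R \<Theta> F of (T, F', g) \<Rightarrow> (connected_sum \<Theta> F g T F', T - {F'})) (pmf_of_set A))"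

text \<open>The state after \<open>m\<close> gluings, when \<open>m + 1\<close> tetrahedra have been used.\<close>

primrec random_chain ::
  "('a set set \<Rightarrow> 'a set \<Rightarrow> 'a set set \<times> 'a set \<times> ('a \<Rightarrow> 'a)) \<Rightarrow> 'a set set \<Rightarrow> nat \<Rightarrow>
   ('a set set \<times> 'a set set) pmf" where
  "random_chain R T 0 = return_pmf (T, T)"
| "random_chain R T (Suc m) = bind_pmf (random_chain R T m) (glue_random R)"

text \<open>The probability \<open>p\<^sup>(\<^sup>k\<^sup>)\<^sub>n\<close>, for \<open>n \<ge> 1\<close>.\<close>

definition zigzag_prob ::
  "('a set set \<Rightarrow> 'a set \<Rightarrow> 'a set set \<times> 'a set \<times> ('a \<Rightarrow> 'a)) \<Rightarrow> 'a set set \<Rightarrow> nat \<Rightarrow> nat \<Rightarrow> real" where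
  "zigzag_prob R T k n =
     measure_pmf.prob (random_chain R T (n - 1)) {(\<Theta>, A). has_zigzags_up_to_reversing \<Theta> k}"

text \<open>Gluing rules exist as soon as there are enough names for vertices.\<close>

lemma tetrahedronD:
  assumes "tetrahedron T"
  shows "finite (\<Union>T)" "F \<in> T \<Longrightarrow> card F = 3" "finite T"
proof -
  obtain V where V: "card V = 4" "T = {F. F \<subseteq> V \<and> card F = 3}"
    using assms by (auto simp: tetrahedron_def)
  then have "finite V" by (intro card_ge_0_finite) simp
  moreover have "\<Union>T \<subseteq> V" "T \<subseteq> Pow V" using V by auto
  ultimately show "finite (\<Union>T)" "finite T" by (auto intro: finite_subset)
  show "F \<in> T \<Longrightarrow> card F = 3" using V by auto
qed

lemma chain_stateD:
  assumes "chain_state n \<Theta> A"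
  shows "A \<subseteq> \<Theta> \<and> finite (\<Union>\<Theta>) \<and> (\<forall>F\<in>A. card F = 3)"
  using assms
proof induction
  case (start T)
  then show ?case by (auto dest: tetrahedronD)
next
  case (step n \<Theta> A F T F' g)
  let ?r = "\<lambda>v. if v \<in> F then g v else v"
  have T: "tetrahedron T" using step by (simp add: tetrahedron_gluing_def)
  have "\<Union>(connected_sum \<Theta> F g T F') \<subseteq> ?r ` \<Union>\<Theta> \<union> \<Union>T"
    unfolding connected_sum_def by blast
  moreover have "finite (?r ` \<Union>\<Theta> \<union> \<Union>T)" using step tetrahedronD(1)[OF T] by blast
  ultimately have "finite (\<Union>(connected_sum \<Theta> F g T F'))" by (rule finite_subset)
  then show ?case using tetrahedronD(2)[OF T] by (auto simp: connected_sum_def)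
qed

lemma tetrahedron_exists:
  assumes "infinite (UNIV :: 'a set)" "finite (X :: 'a set)"
  obtains T F where "tetrahedron T" "X \<inter> \<Union>T = {}" "F \<in> T"
proof -
  have "infinite (- X)" using assms by (simp add: finite_compl)
  then obtain V where V: "V \<subseteq> - X" "card V = 4"
    using infinite_arbitrarily_large[of "- X" 4] by auto
  have "3 \<le> card V" using V(2) by simp
  then obtain F where F: "F \<subseteq> V" "card F = 3"
    by (rule obtain_subset_with_card_n)
  show thesis
  proof (rule that)
    show "tetrahedron {F. F \<subseteq> V \<and> card F = 3}"
      unfolding tetrahedron_def using V(2) by (intro exI[of _ V]) simp
    show "X \<inter> \<Union>{F. F \<subseteq> V \<and> card F = 3} = {}" using V by auto
    show "F \<in> {F. F \<subseteq> V \<and> card F = 3}" using F by simp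
  qed
qed

lemma gluing_rule_exists:
  assumes "infinite (UNIV :: 'a set)"
  obtains R :: "'a set set \<Rightarrow> 'a set \<Rightarrow> 'a set set \<times> 'a set \<times> ('a \<Rightarrow> 'a)"
  where "gluing_rule R"
proof
  have ex: "\<exists>x. tetrahedron_gluing \<Theta> F x"
    if "chain_state n \<Theta> A" "F \<in> A" for n and \<Theta> A :: "'a set set" and F
  proof -
    have \<Theta>: "finite (\<Union>\<Theta>)" "card F = 3" using chain_stateD[OF that(1)] that(2) by auto
    obtain T F' where T: "tetrahedron T" "\<Union>\<Theta> \<inter> \<Union>T = {}" "F' \<in> T"
      using tetrahedron_exists[OF assms \<Theta>(1)] .
    have "card F' = 3" using tetrahedronD(2)[OF T(1,3)] .
    moreover from this \<Theta>(2) have "finite F" "finite F'" by (auto intro: card_ge_0_finite)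
    ultimately obtain g where "bij_betw g F F'"
      using finite_same_card_bij[of F F'] \<Theta>(2) by auto
    with T show ?thesis by (auto simp: tetrahedron_gluing_def)
  qed
  show "gluing_rule (\<lambda>(\<Theta> :: 'a set set) F. SOME x. tetrahedron_gluing \<Theta> F x)"
    unfolding gluing_rule_def
  proof (intro allI impI, elim conjE)
    fix n and \<Theta> A :: "'a set set" and F
    assume "chain_state n \<Theta> A" "F \<in> A"
    from someI_ex[OF ex[OF this]]
    show "tetrahedron_gluing \<Theta> F (SOME x. tetrahedron_gluing \<Theta> F x)" .
  qed
qed

lemma random_chain_state:
  assumes "gluing_rule R" "tetrahedron T" "(\<Theta>, A) \<in> set_pmf (random_chain R T m)"
  shows "chain_state (m + 1) \<Theta> A"
  using assms(3)
proof (induction m arbitrary: \<Theta> A)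
  case 0
  then show ?case using chain_state.start[OF assms(2)] by simp
next
  case (Suc m)
  then obtain \<Theta>' A' where *: "(\<Theta>', A') \<in> set_pmf (random_chain R T m)"
    "(\<Theta>, A) \<in> set_pmf (glue_random R (\<Theta>', A'))" by auto
  have S: "chain_state (m + 1) \<Theta>' A'" using Suc.IH *(1) by blast
  have "card A' \<ge> 3"
    using S
  proof cases
    case start
    then obtain V where V: "card V = 4" "A' = {F. F \<subseteq> V \<and> card F = 3}"
      by (auto simp: tetrahedron_def)
    have "finite V" using V by (intro card_ge_0_finite) simp
    then have "card A' = 4 choose 3" using n_subsets[of V 3] V by simp
    then show ?thesis by (simp add: eval_nat_numeral)
  next
    case (step n \<Theta>0 A0 F T' F' g)
    then obtain V where V: "card V = 4" "T' = {F. F \<subseteq> V \<and> card F = 3}" "F' \<in> T'"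
      by (auto simp: tetrahedron_gluing_def tetrahedron_def)
    have "finite V" using V by (intro card_ge_0_finite) simp
    then have "card T' = 4 choose 3" using n_subsets[of V 3] V by simp
    then have "card T' = 4" by (simp add: eval_nat_numeral)
    then show ?thesis using step V(3) by (simp add: card_Diff_singleton)
  qed
  then have "A' \<noteq> {}" "finite A'" by (auto intro: card_ge_0_finite)
  with *(2) obtain F where F: "F \<in> A'"
    "(\<Theta>, A) = (case R \<Theta>' F of (T, F', g) \<Rightarrow> (connected_sum \<Theta>' F g T F', T - {F'}))"
    by (auto simp: glue_random_def)
  obtain T1 F1 g where R: "R \<Theta>' F = (T1, F1, g)" by (metis prod_cases3)
  have "tetrahedron_gluing \<Theta>' F (T1, F1, g)"
    using assms(1) S F(1) R unfolding gluing_rule_def by metis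
  from chain_state.step[OF S F(1) this] F(2) R show ?case by simp
qed

end

theory Submission
  imports Defs
begin

text \<open>
  A zigzag is the sequence of edges along a vertex sequence in which any three consecutive vertices
  form a face and each of these faces differs from the next one.  So the zigzags are the orbits
  of the permutation \<open>(x, y, z) \<mapsto> (y, z, w)\<close> of the ordered faces.  Removing a face cuts them into
  paths; in a tetrahedral chain there are exactly six paths, one entering through each directed edge
  of the removed face, and path reversal is a perfect matching of these six directed edges.
  Gluing a tetrahedron to the removed face and removing one of the three new faces only prolongs
  the six paths, so it merely relabels the matching.  Closing the removed face adds a second perfect
  matching, and the number of zigzags up to reversing is the number of cycles in the union of the
  two.  Up to rotating the labels there are seven matchings, on which the random construction acts as
  a primitive Markov chain whose stationary distribution comes from the uniform one on all 15
  matchings: 8, 6 and 1 of them yield one, two and three zigzags.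
\<close>

section \<open>Zigzags as orbits on ordered faces\<close>


definition flags :: "'a set set \<Rightarrow> ('a \<times> 'a \<times> 'a) set" where
  "flags \<Gamma> = {(x, y, z). {x, y, z} \<in> \<Gamma>}"

definition step :: "'a set set \<Rightarrow> 'a \<times> 'a \<times> 'a \<Rightarrow> 'a \<times> 'a \<times> 'a \<Rightarrow> bool" where
  "step \<Gamma> = (\<lambda>(x, y, z) (y', z', w).
     y' = y \<and> z' = z \<and> x \<noteq> w \<and> {x, y, z} \<in> \<Gamma> \<and> {y, z, w} \<in> \<Gamma>)"

abbreviation conn :: "'a set set \<Rightarrow> 'a \<times> 'a \<times> 'a \<Rightarrow> 'a \<times> 'a \<times> 'a \<Rightarrow> bool" where
  "conn \<Gamma> \<equiv> equivclp (step \<Gamma>)"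

definition first_edge :: "'a \<times> 'a \<times> 'a \<Rightarrow> 'a set" where
  "first_edge = (\<lambda>(x, y, z). {x, y})"

lemma card_3_distinct: "card {x, y, z} = 3 \<longleftrightarrow> x \<noteq> y \<and> y \<noteq> z \<and> x \<noteq> z"
  by (auto simp: card_insert_if)

lemma triple_eq_iff:
  assumes "card {a, b, c} = 3"
  shows "{x, y, z} = {a, b, c} \<longleftrightarrow>
    (x, y, z) \<in> {(a, b, c), (b, c, a), (c, a, b), (a, c, b), (c, b, a), (b, a, c)}"
proof
  assume eq: "{x, y, z} = {a, b, c}"
  then have "x \<in> {a, b, c}" "y \<in> {a, b, c}" "z \<in> {a, b, c}" by blast+
  moreover have "x \<noteq> y \<and> y \<noteq> z \<and> x \<noteq> z"
    using assms unfolding eq[symmetric] card_3_distinct .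
  ultimately show "(x, y, z) \<in> {(a, b, c), (b, c, a), (c, a, b), (a, c, b), (c, b, a), (b, a, c)}"
    by auto
qed auto

text \<open>In ordered form, \<open>other_face\<close> expresses that each edge of a face lies in
  exactly two faces: opposite \<open>x\<close> across the edge \<open>yz\<close> there is exactly
  one \<open>w\<close>.\<close>

locale closed_surface =
  fixes \<Gamma> :: "'a set set"
  assumes finite_faces: "finite \<Gamma>"
    and card_face: "F \<in> \<Gamma> \<Longrightarrow> card F = 3"
    and other_face: "{x, y, z} \<in> \<Gamma> \<Longrightarrow> \<exists>!w. x \<noteq> w \<and> {y, z, w} \<in> \<Gamma>"
begin

section \<open>The successor permutation on ordered faces\<close>

lemma flag_distinct: "(x, y, z) \<in> flags \<Gamma> \<Longrightarrow> x \<noteq> y \<and> y \<noteq> z \<and> x \<noteq> z"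
  using card_face[of "{x, y, z}"] unfolding flags_def card_3_distinct by simp

lemma finite_flags: "finite (flags \<Gamma>)"
proof (rule finite_subset)
  have "finite (\<Union>\<Gamma>)"
    using finite_faces card_face by (intro finite_Union) (auto intro: card_ge_0_finite)
  then show "finite (\<Union>\<Gamma> \<times> \<Union>\<Gamma> \<times> \<Union>\<Gamma>)" by simp
  show "flags \<Gamma> \<subseteq> \<Union>\<Gamma> \<times> \<Union>\<Gamma> \<times> \<Union>\<Gamma>" by (auto simp: flags_def)
qed

lemma step_functional: "s \<in> flags \<Gamma> \<Longrightarrow> \<exists>!t. step \<Gamma> s t"
proof -
  assume "s \<in> flags \<Gamma>"
  then obtain x y z where s: "s = (x, y, z)" "{x, y, z} \<in> \<Gamma>" by (auto simp: flags_def)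
  from other_face[OF s(2)] obtain w where w: "x \<noteq> w" "{y, z, w} \<in> \<Gamma>"
    "\<And>w'. x \<noteq> w' \<Longrightarrow> {y, z, w'} \<in> \<Gamma> \<Longrightarrow> w' = w" by blast
  show ?thesis
  proof (rule ex1I[of _ "(y, z, w)"])
    show "step \<Gamma> s (y, z, w)" using s w(1,2) by (simp add: step_def)
    show "t = (y, z, w)" if "step \<Gamma> s t" for t
      using that s(1) w(3) by (cases t) (simp add: step_def)
  qed
qed

text \<open>Reversing both triples turns a step into a step, so \<open>other_face\<close> at the
  reversed target \<open>(w, z, y)\<close> determines the predecessor.\<close>

lemma step_injective: "step \<Gamma> s t \<Longrightarrow> step \<Gamma> s' t \<Longrightarrow> s = s'"
proof -
  assume *: "step \<Gamma> s t" "step \<Gamma> s' t"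
  then obtain x x' y z w where "s = (x, y, z)" "s' = (x', y, z)" "x \<noteq> w" "x' \<noteq> w"
    "{x, y, z} \<in> \<Gamma>" "{x', y, z} \<in> \<Gamma>" "{y, z, w} \<in> \<Gamma>"
    by (auto simp: step_def)
  with other_face[of w z y] show ?thesis by (auto simp: insert_commute)
qed

lemma step_flags: "step \<Gamma> s t \<Longrightarrow> s \<in> flags \<Gamma> \<and> t \<in> flags \<Gamma>"
  by (auto simp: step_def flags_def)

text \<open>Triples that are not ordered faces are fixed, so that \<open>nxt\<close> is injective on
  the whole type and its finite orbits are periodic.\<close>

definition nxt :: "'a \<times> 'a \<times> 'a \<Rightarrow> 'a \<times> 'a \<times> 'a" where
  "nxt s = (if s \<in> flags \<Gamma> then THE t. step \<Gamma> s t else s)"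

lemma step_nxt: "s \<in> flags \<Gamma> \<Longrightarrow> step \<Gamma> s (nxt s)"
  unfolding nxt_def using theI'[OF step_functional] by simp

lemma nxt_eqI: "step \<Gamma> s t \<Longrightarrow> nxt s = t"
  using step_flags step_nxt step_functional by blast

lemma nxt_flags: "nxt s \<in> flags \<Gamma> \<longleftrightarrow> s \<in> flags \<Gamma>"
  using step_nxt step_flags by (metis nxt_def)

lemma funpow_nxt_flags: "(nxt ^^ k) s \<in> flags \<Gamma> \<longleftrightarrow> s \<in> flags \<Gamma>"
  by (induction k) (auto simp: nxt_flags)

lemma inj_nxt: "inj nxt"
proof (rule injI)
  fix s t assume eq: "nxt s = nxt t"
  show "s = t"
  proof (cases "s \<in> flags \<Gamma>")
    case True
    then have "t \<in> flags \<Gamma>" using eq nxt_flags by metis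
    with True show ?thesis using step_nxt step_injective eq by metis
  next
    case False
    then have "t \<notin> flags \<Gamma>" using eq nxt_flags by metis
    with False show ?thesis using eq by (simp add: nxt_def)
  qed
qed

definition orb :: "'a \<times> 'a \<times> 'a \<Rightarrow> ('a \<times> 'a \<times> 'a) set" where
  "orb s = range (\<lambda>k. (nxt ^^ k) s)"

lemma orb_refl: "s \<in> orb s"
  unfolding orb_def by (rule range_eqI[of _ _ 0]) simp

text \<open>An injective map with a finite orbit returns to its starting point, so a forward orbit
  is a full cycle and may be started at any of its members.\<close>

lemma orb_nxt:
  assumes "s \<in> flags \<Gamma>"
  shows "orb (nxt s) = orb s"
proof
  show "orb (nxt s) \<subseteq> orb s"
  proof
    fix t assume "t \<in> orb (nxt s)"
    then obtain k where "t = (nxt ^^ k) (nxt s)" unfolding orb_def by blast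
    then have "t = (nxt ^^ Suc k) s" unfolding funpow_Suc_right by simp
    then show "t \<in> orb s" unfolding orb_def by blast
  qed
  have "finite {y. \<exists>n. y = (nxt ^^ n) s}"
    using assms funpow_nxt_flags[of _ s] by (intro finite_subset[OF _ finite_flags]) blast
  then obtain n where n: "n > 0" "(nxt ^^ n) s = s"
    using funpow_inj_finite[OF inj_nxt] by metis
  then obtain m where m: "n = Suc m" by (cases n) auto
  show "orb s \<subseteq> orb (nxt s)"
  proof
    fix t assume "t \<in> orb s"
    then obtain k where "t = (nxt ^^ k) s" by (auto simp: orb_def)
    also have "\<dots> = (nxt ^^ (k + n)) s" using n by (simp add: funpow_add)
    also have "\<dots> = (nxt ^^ (k + m)) (nxt s)"
      using m by (metis add_Suc_right comp_apply funpow_Suc_right)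
    finally show "t \<in> orb (nxt s)" by (auto simp: orb_def)
  qed
qed

lemma orb_conn:
  assumes "conn \<Gamma> s t"
  shows "orb s = orb t"
  using assms
proof (induction rule: equivclp_induct)
  case (step y z)
  then show ?case using orb_nxt nxt_eqI step_flags by metis
qed simp

section \<open>Zigzags as edge sequences of orbits\<close>

definition edge_seq :: "'a \<times> 'a \<times> 'a \<Rightarrow> nat \<Rightarrow> 'a set" where
  "edge_seq s i = first_edge ((nxt ^^ i) s)"

lemma edge_seq_shift: "(\<lambda>i. edge_seq s (i + k)) = edge_seq ((nxt ^^ k) s)"
  by (rule ext) (simp add: edge_seq_def funpow_add)

lemma cyclic_sequence_edge_seq: "cyclic_sequence (edge_seq s) = edge_seq ` orb s"
  unfolding cyclic_sequence_def edge_seq_shift orb_def by auto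

text \<open>The first two edges \<open>{x, y}\<close> and \<open>{y, z}\<close> meet exactly in
  \<open>y\<close>, which already recovers the ordered face.\<close>

lemma inj_on_edge_seq: "inj_on edge_seq (flags \<Gamma>)"
proof (rule inj_onI)
  fix s t assume *: "s \<in> flags \<Gamma>" "t \<in> flags \<Gamma>" "edge_seq s = edge_seq t"
  obtain x y z w where s: "s = (x, y, z)" "nxt s = (y, z, w)"
    using step_nxt[OF *(1)] by (auto simp: step_def)
  obtain x' y' z' w' where t: "t = (x', y', z')" "nxt t = (y', z', w')"
    using step_nxt[OF *(2)] by (auto simp: step_def)
  have "{x, y} = {x', y'}" "{y, z} = {y', z'}"
    using fun_cong[OF *(3), of 0] fun_cong[OF *(3), of 1] s t
    by (simp_all add: edge_seq_def first_edge_def)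
  moreover have "x \<noteq> y \<and> y \<noteq> z \<and> x \<noteq> z" using flag_distinct * s by simp
  ultimately show "s = t" using s t by (auto simp: doubleton_eq_iff)
qed

lemma edge_seq_zigzag:
  assumes "s \<in> flags \<Gamma>"
  shows "zigzag \<Gamma> (edge_seq s)"
  unfolding zigzag_def
proof (intro allI conjI ballI impI)
  fix i
  have fl: "(nxt ^^ i) s \<in> flags \<Gamma>" using assms funpow_nxt_flags by simp
  obtain x y z w where 0: "(nxt ^^ i) s = (x, y, z)" "(nxt ^^ (i + 1)) s = (y, z, w)" "x \<noteq> w"
    "{x, y, z} \<in> \<Gamma>" "{y, z, w} \<in> \<Gamma>"
    using step_nxt[OF fl] by (auto simp: step_def)
  obtain v where 1: "(nxt ^^ (i + 2)) s = (z, w, v)"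
    using step_nxt[of "(y, z, w)"] 0(2,5) by (auto simp: step_def flags_def)
  have d: "x \<noteq> y \<and> y \<noteq> z \<and> x \<noteq> z" "y \<noteq> z \<and> z \<noteq> w \<and> y \<noteq> w"
    using 0 card_face card_3_distinct by metis+
  have e: "edge_seq s i = {x, y}" "edge_seq s (i + 1) = {y, z}" "edge_seq s (i + 2) = {z, w}"
    using 0 1 by (simp_all only: edge_seq_def first_edge_def split)
  show "adjacent \<Gamma> (edge_seq s i) (edge_seq s (i + 1))"
    unfolding e adjacent_def edges_def using d(1) 0(4)
    by (auto simp: card_insert_if doubleton_eq_iff intro!: bexI[of _ "{x, y, z}"])
  show "edge_seq s i \<inter> edge_seq s (i + 2) = {}" unfolding e using d 0(3) by auto
  fix F F' assume F: "F \<in> \<Gamma>" "F' \<in> \<Gamma>" and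
    "edge_seq s i \<union> edge_seq s (i + 1) \<subseteq> F \<and> edge_seq s (i + 1) \<union> edge_seq s (i + 2) \<subseteq> F'"
  then have sub: "{x, y, z} \<subseteq> F" "{y, z, w} \<subseteq> F'" unfolding e by auto
  \<comment> \<open>A face has three vertices, so three distinct vertices inside it are all of
    it.\<close>
  have eq: "{x, y, z} = F" "{y, z, w} = F'"
    using sub F 0 card_face by (metis card_subset_eq card.infinite zero_neq_numeral)+
  show "F \<noteq> F'" using 0(3) d unfolding eq[symmetric] by auto
qed

lemma adjacent_flag:
  assumes "adjacent \<Gamma> e e'"
  shows "\<exists>x y z. e = {x, y} \<and> e' = {y, z} \<and> {x, y, z} \<in> \<Gamma>"
proof -
  obtain F where F: "F \<in> \<Gamma>" "e \<subseteq> F" "e' \<subseteq> F" "card e = 2" "card e' = 2" "e \<noteq> e'"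
    using assms by (auto simp: adjacent_def edges_def)
  obtain x y where e: "e = {x, y}" "x \<noteq> y" using F(4) card_2_iff by metis
  obtain z where z: "F = {x, y, z}" "z \<noteq> x" "z \<noteq> y"
  proof -
    have "card (F - e) = 1" using F card_face by (subst card_Diff_subset) (auto simp: e)
    then obtain z where "F - e = {z}" by (auto simp: card_1_singleton_iff)
    with F e show thesis by (intro that[of z]) auto
  qed
  obtain u v where e': "e' = {u, v}" "u \<noteq> v" using F(5) card_2_iff by metis
  \<comment> \<open>The vertex shared by the two edges must become the middle one; in the second
    case \<open>x\<close> and \<open>y\<close> are exchanged.\<close>
  have "e' = {y, z} \<or> e' = {x, z}" using F(3,6) e e' z by auto
  then show ?thesis
  proof
    assume "e' = {y, z}"
    then show ?thesis using e(1) z(1) F(1) by blast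
  next
    assume "e' = {x, z}"
    moreover have "e = {y, x}" "F = {y, x, z}" using e(1) z(1) by auto
    ultimately show ?thesis using F(1) by blast
  qed
qed

text \<open>Two consecutive edges order the vertices of a face. Disjointness of each edge from the
  next but one makes these orderings overlap, so that they follow an orbit of
  \<open>nxt\<close>.\<close>

lemma zigzag_edge_seq:
  assumes "zigzag \<Gamma> e"
  obtains s where "s \<in> flags \<Gamma>" "e = edge_seq s"
proof -
  have "\<forall>i. \<exists>x y z. e i = {x, y} \<and> e (i + 1) = {y, z} \<and> {x, y, z} \<in> \<Gamma>"
    using assms adjacent_flag unfolding zigzag_def by blast
  then obtain x y z where *: "\<And>i. e i = {x i, y i}" "\<And>i. e (i + 1) = {y i, z i}"
    "\<And>i. {x i, y i, z i} \<in> \<Gamma>"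
    by metis
  define s where "s i = (x i, y i, z i)" for i
  have st: "step \<Gamma> (s i) (s (i + 1))" for i
  proof -
    have disj: "e i \<inter> e (i + 2) = {}" using assms by (simp add: zigzag_def)
    have e2: "e (i + 2) = {y (i + 1), z (i + 1)}" using *(2)[of "i + 1"] by simp
    have "{x (i + 1), y (i + 1)} = {y i, z i}" using *(1)[of "i + 1"] *(2)[of i] by simp
    \<comment> \<open>\<open>y (i + 1)\<close> lies in \<open>e (i + 2)\<close>, hence not in
      \<open>e i\<close>, so both neighbouring triples direct the edge \<open>e (i + 1)\<close> in
      the same way.\<close>
    moreover have "y (i + 1) \<noteq> y i" using disj e2 *(1)[of i] by auto
    ultimately have "x (i + 1) = y i" "y (i + 1) = z i" by (auto simp: doubleton_eq_iff)
    moreover have "x i \<noteq> z (i + 1)" using disj e2 *(1)[of i] by auto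
    ultimately show ?thesis
      unfolding step_def s_def using *(3)[of i] *(3)[of "i + 1"] by auto
  qed
  have "s i = (nxt ^^ i) (s 0)" for i
  proof (induction i)
    case (Suc i)
    have "s (Suc i) = nxt (s i)" using nxt_eqI[OF st[of i]] by simp
    then show ?case using Suc by simp
  qed simp
  then have "edge_seq (s 0) i = first_edge (s i)" for i unfolding edge_seq_def by metis
  then have "edge_seq (s 0) i = e i" for i
    using *(1)[of i] by (simp add: first_edge_def s_def)
  moreover have "s 0 \<in> flags \<Gamma>" using *(3) by (simp add: s_def flags_def)
  ultimately show thesis by (intro that[of "s 0"]) auto
qed

text \<open>\<open>\<kappa>\<close> is a complete invariant of the components of
  \<open>step\<close>, and these components correspond to the cyclic edge sequences.\<close>

lemma card_zigzags:
  fixes \<kappa> :: "'a \<times> 'a \<times> 'a \<Rightarrow> 'k"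
  assumes inv: "\<And>s t. step \<Gamma> s t \<Longrightarrow> \<kappa> s = \<kappa> t"
    and conn: "\<And>s t. s \<in> flags \<Gamma> \<Longrightarrow> t \<in> flags \<Gamma> \<Longrightarrow> \<kappa> s = \<kappa> t \<Longrightarrow> conn \<Gamma> s t"
  shows "finite (zigzags \<Gamma>)" "card (zigzags \<Gamma>) = card (\<kappa> ` flags \<Gamma>)"
proof -
  define \<Phi> where "\<Phi> s = cyclic_sequence (edge_seq s)" for s
  have Z: "zigzags \<Gamma> = \<Phi> ` flags \<Gamma>"
  proof -
    have "{e. zigzag \<Gamma> e} = edge_seq ` flags \<Gamma>"
      using edge_seq_zigzag by (auto elim: zigzag_edge_seq)
    then show ?thesis by (simp add: zigzags_def image_image \<Phi>_def)
  qed
  have orb_sub: "orb s \<subseteq> flags \<Gamma>" if "s \<in> flags \<Gamma>" for s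
    using that funpow_nxt_flags[of _ s] unfolding orb_def by blast
  have \<kappa>_orb: "\<kappa> t = \<kappa> s" if "s \<in> flags \<Gamma>" "t \<in> orb s" for s t
  proof -
    have "\<kappa> ((nxt ^^ k) s) = \<kappa> s" for k
      by (induction k) (use inv step_nxt funpow_nxt_flags that(1) in \<open>auto, metis\<close>)
    then show ?thesis using that(2) by (auto simp: orb_def)
  qed
  have \<Phi>: "\<Phi> s = \<Phi> t \<longleftrightarrow> \<kappa> s = \<kappa> t" if st: "s \<in> flags \<Gamma>" "t \<in> flags \<Gamma>" for s t
  proof
    assume "\<Phi> s = \<Phi> t"
    then have "orb s = orb t"
      unfolding \<Phi>_def cyclic_sequence_edge_seq
      using inj_on_image_eq_iff[OF inj_on_edge_seq orb_sub orb_sub] st by simp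
    then show "\<kappa> s = \<kappa> t" using \<kappa>_orb[of s t] orb_refl[of t] st by simp
  next
    assume "\<kappa> s = \<kappa> t"
    then show "\<Phi> s = \<Phi> t"
      unfolding \<Phi>_def cyclic_sequence_edge_seq using orb_conn conn st by metis
  qed
  show "finite (zigzags \<Gamma>)" unfolding Z using finite_flags by simp
  \<comment> \<open>Any ordered face may represent its value of \<open>\<kappa>\<close>, since
    \<open>\<Phi>\<close> depends only on that value.\<close>
  define g where "g = \<Phi> \<circ> inv_into (flags \<Gamma>) \<kappa>"
  have g: "g (\<kappa> s) = \<Phi> s" if "s \<in> flags \<Gamma>" for s
    using that \<Phi>[of "inv_into (flags \<Gamma>) \<kappa> (\<kappa> s)" s]
    by (simp add: g_def f_inv_into_f inv_into_into)
  have "bij_betw g (\<kappa> ` flags \<Gamma>) (zigzags \<Gamma>)"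
    unfolding Z using g \<Phi> by (auto simp: bij_betw_def inj_on_def image_image)
  then show "card (zigzags \<Gamma>) = card (\<kappa> ` flags \<Gamma>)" by (metis bij_betw_same_card)
qed

end

section \<open>Triangulations with one face removed\<close>

text \<open>The first three entries run around the boundary; entries \<open>j\<close> and
  \<open>j + 3\<close> are reverses of each other.\<close>

definition bdry :: "'a \<Rightarrow> 'a \<Rightarrow> 'a \<Rightarrow> ('a \<times> 'a) list" where
  "bdry a b c = [(a, b), (b, c), (c, a), (b, a), (c, b), (a, c)]"

text \<open>The apexes of the faces on the edge \<open>xy\<close>; in a patch there are two for an
  inner edge and one for a boundary edge.\<close>

definition link :: "'a set set \<Rightarrow> 'a \<Rightarrow> 'a \<Rightarrow> 'a set" where
  "link P x y = {w. {x, y, w} \<in> P}"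

text \<open>
  \<open>P\<close> is a closed triangulation without its face \<open>abc\<close>.  The label of an ordered face is the path
  containing it, numbered by the position in \<open>bdry a b c\<close> of the directed edge through which the path
  enters \<open>P\<close>; and \<open>M ! j\<close> is the number of the reverse of path \<open>j\<close>.
  The face \<open>abc\<close> alone also satisfies the conditions, and every chain grows from it.
\<close>

locale patch =
  fixes P :: "'a set set" and a b c :: 'a and M :: "nat list"
    and label :: "'a \<times> 'a \<times> 'a \<Rightarrow> nat"
  assumes finite_faces: "finite P"
    and card_face: "F \<in> P \<Longrightarrow> card F = 3"
    and card_bdry: "card {a, b, c} = 3"
    and link_bdry: "\<exists>w. link P a b = {w}" "\<exists>w. link P b c = {w}" "\<exists>w. link P c a = {w}"
    and link_inner: "link P x y = {} \<or> {x, y} \<subseteq> {a, b, c} \<or> (\<exists>u v. u \<noteq> v \<and> link P x y = {u, v})"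
    and label_less: "s \<in> flags P \<Longrightarrow> label s < 6"
    and label_step: "step P s t \<Longrightarrow> label s = label t"
    and label_conn: "s \<in> flags P \<Longrightarrow> t \<in> flags P \<Longrightarrow> label s = label t \<Longrightarrow> conn P s t"
    and label_in: "j < 6 \<Longrightarrow> bdry a b c ! j = (x, y) \<Longrightarrow> {x, y, w} \<in> P \<Longrightarrow> label (x, y, w) = j"
    and label_out: "j < 6 \<Longrightarrow> bdry a b c ! j = (x, y) \<Longrightarrow> {x, y, w} \<in> P \<Longrightarrow> label (w, y, x) = M ! j"

lemma link_commute: "link P x y = link P y x"
  by (simp add: link_def insert_commute)

lemma conn_mono:
  assumes "P \<subseteq> Q" "conn P s t"
  shows "conn Q s t"
proof -
  have "step Q x y" if "step P x y" for x y using that assms(1) by (auto simp: step_def)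
  from assms(2) this show ?thesis
  proof (induction rule: equivclp_induct)
    case (step y z)
    then show ?case by (meson equivclp_into_equivclp)
  qed simp
qed

text \<open>
  When \<open>bcd\<close> and \<open>cad\<close> are added, the boundary becomes \<open>abd\<close>.  The path entering through
  edge \<open>j\<close> of \<open>bdry a b d\<close> continues the one that entered through edge \<open>old_label ! j\<close> of \<open>bdry a b c\<close>;
  \<open>new_label\<close> is the inverse renaming.
\<close>

definition old_label :: "nat list" where "old_label = [0, 2, 5, 3, 1, 4]"
definition new_label :: "nat list" where "new_label = [0, 4, 1, 3, 5, 2]"

text \<open>This is \<open>M\<close> conjugated by the renaming of paths, hence a matching whenever
  \<open>M\<close> is one.\<close>

definition extend :: "nat list \<Rightarrow> nat list" where
  "extend M = map (\<lambda>j. new_label ! (M ! (old_label ! j))) [0..<6]"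

lemma less_6_cases: "j < 6 \<Longrightarrow> j = 0 \<or> j = 1 \<or> j = 2 \<or> j = 3 \<or> j = 4 \<or> j = (5::nat)"
  by linarith

section \<open>Adding two triangles with a fresh vertex\<close>

context patch
begin

lemma distinct_bdry: "a \<noteq> b" "b \<noteq> a" "b \<noteq> c" "c \<noteq> b" "a \<noteq> c" "c \<noteq> a"
  using card_bdry unfolding card_3_distinct by auto

lemma bdry_Union: "a \<in> \<Union>P" "b \<in> \<Union>P" "c \<in> \<Union>P"
  using link_bdry by (auto simp: link_def)

lemma label_entering:
  "{a, b, w} \<in> P \<Longrightarrow> label (a, b, w) = 0" "{b, c, w} \<in> P \<Longrightarrow> label (b, c, w) = 1"
  "{c, a, w} \<in> P \<Longrightarrow> label (c, a, w) = 2" "{b, a, w} \<in> P \<Longrightarrow> label (b, a, w) = 3"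
  "{c, b, w} \<in> P \<Longrightarrow> label (c, b, w) = 4" "{a, c, w} \<in> P \<Longrightarrow> label (a, c, w) = 5"
  by (rule label_in; simp add: bdry_def)+

text \<open>An ordered face ending in a boundary edge is the last of its path; its reversal enters
  through the reversed edge, so \<open>M\<close> gives the label.\<close>

lemma label_leaving:
  "{w, b, a} \<in> P \<Longrightarrow> label (w, b, a) = M ! 0" "{w, c, b} \<in> P \<Longrightarrow> label (w, c, b) = M ! 1"
  "{w, a, c} \<in> P \<Longrightarrow> label (w, a, c) = M ! 2" "{w, a, b} \<in> P \<Longrightarrow> label (w, a, b) = M ! 3"
  "{w, b, c} \<in> P \<Longrightarrow> label (w, b, c) = M ! 4" "{w, c, a} \<in> P \<Longrightarrow> label (w, c, a) = M ! 5"
  by (rule label_out; simp add: bdry_def insert_commute)+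

text \<open>As \<open>d\<close> is fresh, the new faces meet \<open>P\<close> only along
  \<open>bc\<close> and \<open>ca\<close>. Each of their twelve orderings continues a path leaving
  through these edges or precedes one entering through them, so no path is closed or
  created.\<close>

lemma patch_extend:
  assumes d: "d \<notin> \<Union>P" and M: "\<And>j. j < 6 \<Longrightarrow> M ! j < 6"
  shows "\<exists>label'. patch (P \<union> {{b, c, d}, {c, a, d}}) a b d (extend M) label'"
proof -
  let ?P = "P \<union> {{b, c, d}, {c, a, d}}"
  \<comment> \<open>The twelve new ordered faces, with the old path that each of them prolongs.\<close>
  define lab where "lab = map_of
    [((b, c, d), M ! 4), ((c, d, a), M ! 4), ((a, c, d), M ! 2), ((c, d, b), M ! 2),
     ((c, b, d), M ! 1), ((c, a, d), M ! 5), ((b, d, c), 2), ((d, c, a), 2),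
     ((a, d, c), 4), ((d, c, b), 4), ((d, b, c), 1), ((d, a, c), 5)]"
  \<comment> \<open>\<open>label0\<close> keeps the numbering by the old boundary;
    \<open>label'\<close> translates it to the new one.\<close>
  define label0 where "label0 = (\<lambda>s. case lab s of None \<Rightarrow> label s | Some l \<Rightarrow> l)"
  define label' where "label' s = new_label ! label0 s" for s
  have ne: "d \<noteq> a" "d \<noteq> b" "d \<noteq> c" "a \<noteq> d" "b \<noteq> d" "c \<noteq> d"
    using d bdry_Union by auto
  note ne = this distinct_bdry
  have card_new: "card {b, c, d} = 3" "card {c, a, d} = 3" "card {a, b, d} = 3"
    using ne unfolding card_3_distinct by auto
  have P_d: "{x, y, z} \<in> P \<Longrightarrow> x \<noteq> d \<and> y \<noteq> d \<and> z \<noteq> d" for x y z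
    using d by blast
  define N where "N = {(b, c, d), (c, d, a), (a, c, d), (c, d, b), (c, b, d), (c, a, d),
     (b, d, c), (d, c, a), (a, d, c), (d, c, b), (d, b, c), (d, a, c)}"
  have mem: "{x, y, z} \<in> ?P \<longleftrightarrow> {x, y, z} \<in> P \<or> (x, y, z) \<in> N" for x y z
  proof -
    have "{x, y, z} \<in> ?P \<longleftrightarrow> {x, y, z} \<in> P \<or> {x, y, z} = {b, c, d} \<or> {x, y, z} = {c, a, d}"
      by blast
    then show ?thesis
      unfolding triple_eq_iff[OF card_new(1)] triple_eq_iff[OF card_new(2)] N_def
      by (simp only: insert_iff empty_iff simp_thms disj_ac)
  qed
  have flags: "flags ?P = flags P \<union> N"
    unfolding flags_def mem by blast
  have N_d: "s \<in> N \<Longrightarrow> s \<notin> flags P" for s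
    unfolding N_def flags_def using P_d by auto
  have lab_old: "s \<in> flags P \<Longrightarrow> lab s = None" for s
  proof -
    assume "s \<in> flags P"
    then have "s \<notin> N" using N_d by blast
    moreover have "dom lab = N"
      unfolding lab_def dom_map_of_conv_image_fst N_def
      by (simp only: list.set image_insert image_empty fst_conv)
    ultimately show "lab s = None" by blast
  qed
  have label_old: "s \<in> flags P \<Longrightarrow> label0 s = label s" for s
    using lab_old by (simp add: label0_def)
  have label_new: "label0 (b, c, d) = M ! 4" "label0 (c, d, a) = M ! 4" "label0 (a, c, d) = M ! 2"
    "label0 (c, d, b) = M ! 2" "label0 (c, b, d) = M ! 1" "label0 (c, a, d) = M ! 5"
    "label0 (b, d, c) = 2" "label0 (d, c, a) = 2" "label0 (a, d, c) = 4" "label0 (d, c, b) = 4"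
    "label0 (d, b, c) = 1" "label0 (d, a, c) = 5"
    using ne by (simp_all add: label0_def lab_def)
  \<comment> \<open>\<open>u\<close> and \<open>v\<close> are the apexes of the only old faces on
    \<open>bc\<close> and \<open>ca\<close>; every step between old and new faces uses one of these
    two faces.\<close>
  obtain u where u: "link P b c = {u}" using link_bdry by blast
  obtain v where v: "link P c a = {v}" using link_bdry by blast
  have uv: "{b, c, u} \<in> P" "{c, b, u} \<in> P" "{c, a, v} \<in> P" "{a, c, v} \<in> P"
    "{u, c, b} \<in> P" "{u, b, c} \<in> P" "{v, a, c} \<in> P" "{v, c, a} \<in> P"
    using u v by (auto simp: link_def insert_commute)
  have uv_d: "u \<noteq> d" "v \<noteq> d" using P_d[OF uv(1)] P_d[OF uv(3)] by auto
  have step0: "label0 s = label0 s'" if st: "step ?P s s'" for s s'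
  proof -
    obtain x y z w where s: "s = (x, y, z)" "s' = (y, z, w)" "x \<noteq> w"
      "{x, y, z} \<in> ?P" "{y, z, w} \<in> ?P"
      using st unfolding step_def by blast
    consider "{x, y, z} \<in> P" "{y, z, w} \<in> P" | "{x, y, z} \<in> P" "(y, z, w) \<in> N"
      | "(x, y, z) \<in> N" "{y, z, w} \<in> P" | "(x, y, z) \<in> N" "(y, z, w) \<in> N"
      using s(4,5) unfolding mem by blast
    then show ?thesis
    proof cases
      case 1
      then have "step P s s'" using s by (simp add: step_def)
      then show ?thesis using label_step label_old 1 s by (simp add: flags_def)
    next
      case 2
      then have "label0 s = label s" "y \<noteq> d" "z \<noteq> d" using label_old s P_d by (auto simp: flags_def)
      \<comment> \<open>The common edge avoids \<open>d\<close>, which leaves the four new orderings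
        that start along \<open>bc\<close> or \<open>ca\<close> in either direction.\<close>
      moreover have "(y, z, w) = (b, c, d) \<or> (y, z, w) = (c, b, d) \<or> (y, z, w) = (c, a, d) \<or>
        (y, z, w) = (a, c, d)"
        using 2(2) calculation unfolding N_def by auto
      ultimately show ?thesis using label_leaving 2(1) label_new s by auto
    next
      case 3
      then have "label0 s' = label s'" "y \<noteq> d" "z \<noteq> d" using label_old s P_d by (auto simp: flags_def)
      moreover have "(x, y, z) = (d, b, c) \<or> (x, y, z) = (d, c, b) \<or> (x, y, z) = (d, a, c) \<or>
        (x, y, z) = (d, c, a)"
        using 3(1) calculation unfolding N_def by auto
      ultimately show ?thesis using label_entering 3(2) label_new s by auto
    next
      case 4
      then show ?thesis using s(3) ne label_new unfolding s(1,2) N_def by auto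
    qed
  qed
  \<comment> \<open>Each new ordered face is within two steps of an old one on the same path, so
    connectedness of equally labelled faces is inherited from \<open>P\<close>.\<close>
  have attach: "\<exists>s'\<in>flags P. conn ?P s s' \<and> label0 s = label s'" if "s \<in> N" for s
  proof -
    have N: "(b, c, d) \<in> N" "(c, d, a) \<in> N" "(a, c, d) \<in> N" "(c, d, b) \<in> N" "(c, b, d) \<in> N"
      "(c, a, d) \<in> N" "(b, d, c) \<in> N" "(d, c, a) \<in> N" "(a, d, c) \<in> N" "(d, c, b) \<in> N"
      "(d, b, c) \<in> N" "(d, a, c) \<in> N"
      by (simp_all add: N_def)
    have st: "step ?P (u, b, c) (b, c, d)" "step ?P (b, c, d) (c, d, a)"
      "step ?P (v, a, c) (a, c, d)" "step ?P (a, c, d) (c, d, b)"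
      "step ?P (u, c, b) (c, b, d)" "step ?P (v, c, a) (c, a, d)"
      "step ?P (b, d, c) (d, c, a)" "step ?P (d, c, a) (c, a, v)"
      "step ?P (a, d, c) (d, c, b)" "step ?P (d, c, b) (c, b, u)"
      "step ?P (d, b, c) (b, c, u)" "step ?P (d, a, c) (a, c, v)"
      unfolding step_def split mem using N ne uv uv_d by blast+
    have cn: "conn ?P s s'" if "step ?P s s' \<or> step ?P s' s" for s s'
      using that by (auto intro: r_into_equivclp equivclp_sym)
    have cn2: "conn ?P s s''" if "step ?P s s' \<or> step ?P s' s" "step ?P s' s'' \<or> step ?P s'' s'"
      for s s' s'' by (rule equivclp_trans[OF cn[OF that(1)] cn[OF that(2)]])
    have fl: "(u, b, c) \<in> flags P" "(u, c, b) \<in> flags P" "(v, a, c) \<in> flags P" "(v, c, a) \<in> flags P"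
       "(c, a, v) \<in> flags P" "(c, b, u) \<in> flags P" "(b, c, u) \<in> flags P" "(a, c, v) \<in> flags P"
      using uv by (auto simp: flags_def)
    have cp: "label (u, b, c) = M ! 4" "label (u, c, b) = M ! 1" "label (v, a, c) = M ! 2"
      "label (v, c, a) = M ! 5" "label (c, a, v) = 2" "label (c, b, u) = 4" "label (b, c, u) = 1"
      "label (a, c, v) = 5"
      using uv label_entering label_leaving by auto
    from that show ?thesis
      unfolding N_def
    proof (elim insertE emptyE)
      assume "s = (b, c, d)"
      then show ?thesis using cn[of s "(u, b, c)"] st fl cp label_new by metis
    next
      assume "s = (c, d, b)"
      then show ?thesis using cn2[of s "(a, c, d)" "(v, a, c)"] st fl cp label_new by metis
    next
      assume "s = (d, b, c)"
      then show ?thesis using cn[of s "(b, c, u)"] st fl cp label_new by metis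
    next
      assume "s = (b, d, c)"
      then show ?thesis using cn2[of s "(d, c, a)" "(c, a, v)"] st fl cp label_new by metis
    next
      assume "s = (d, c, b)"
      then show ?thesis using cn[of s "(c, b, u)"] st fl cp label_new by metis
    next
      assume "s = (c, b, d)"
      then show ?thesis using cn[of s "(u, c, b)"] st fl cp label_new by metis
    next
      assume "s = (c, a, d)"
      then show ?thesis using cn[of s "(v, c, a)"] st fl cp label_new by metis
    next
      assume "s = (a, d, c)"
      then show ?thesis using cn2[of s "(d, c, b)" "(c, b, u)"] st fl cp label_new by metis
    next
      assume "s = (d, c, a)"
      then show ?thesis using cn[of s "(c, a, v)"] st fl cp label_new by metis
    next
      assume "s = (c, d, a)"
      then show ?thesis using cn2[of s "(b, c, d)" "(u, b, c)"] st fl cp label_new by metis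
    next
      assume "s = (d, a, c)"
      then show ?thesis using cn[of s "(a, c, v)"] st fl cp label_new by metis
    next
      assume "s = (a, c, d)"
      then show ?thesis using cn[of s "(v, a, c)"] st fl cp label_new by metis
    qed
  qed
  have attach': "\<exists>s'\<in>flags P. conn ?P s s' \<and> label0 s = label s'" if "s \<in> flags ?P" for s
    using that attach label_old unfolding flags by (metis Un_iff equivclp_refl)
  have less0: "label0 s < 6" if "s \<in> flags ?P" for s
    using attach'[OF that] label_less by auto
  have inj: "inj_on ((!) new_label) {..<6}"
    by (auto simp: inj_on_def new_label_def dest!: less_6_cases)
  have link: "link ?P x y = link P x y \<union> {w. (x, y, w) \<in> N}" for x y
    unfolding link_def mem by auto
  have link_d: "link P d y = {}" "link P x d = {}" for x y
    using P_d by (auto simp: link_def)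
  have "patch ?P a b d (extend M) label'"
  proof
    show "finite ?P" using finite_faces by simp
    show "card F = 3" if "F \<in> ?P" for F using that card_face card_new by auto
    show "card {a, b, d} = 3" using card_new by simp
    show "\<exists>w. link ?P a b = {w}" unfolding link N_def using ne link_bdry(1) by auto
    show "\<exists>w. link ?P b d = {w}" unfolding link link_d N_def using ne by auto
    show "\<exists>w. link ?P d a = {w}" unfolding link link_d N_def using ne by auto
    show "label' s < 6" if "s \<in> flags ?P" for s
      using less_6_cases[OF less0[OF that]] by (auto simp: label'_def new_label_def)
    show "label' s = label' s'" if "step ?P s s'" for s s' using step0[OF that] by (simp add: label'_def)
    show "conn ?P s s'" if *: "s \<in> flags ?P" "s' \<in> flags ?P" "label' s = label' s'" for s s'
    proof -
      have eq: "label0 s = label0 s'"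
        using inj_onD[OF inj *(3)[unfolded label'_def]] less0 * by simp
      obtain r r' where r: "r \<in> flags P" "r' \<in> flags P" "conn ?P s r" "conn ?P s' r'"
        "label0 s = label r" "label0 s' = label r'"
        using attach'[OF *(1)] attach'[OF *(2)] by auto
      then have "conn P r r'" using label_conn eq by simp
      then have "conn ?P r r'" by (rule conn_mono[rotated]) blast
      with r(3,4) show ?thesis by (meson equivclp_sym equivclp_trans)
    qed
    have card_P: "x \<noteq> y" if "{x, y, z} \<in> ?P" for x y z
    proof -
      have "card {x, y, z} = 3" using that card_face card_new by auto
      then show ?thesis unfolding card_3_distinct by blast
    qed
    show "link ?P x y = {} \<or> {x, y} \<subseteq> {a, b, d} \<or> (\<exists>p q. p \<noteq> q \<and> link ?P x y = {p, q})" for x y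
    proof -
      \<comment> \<open>\<open>bc\<close> and \<open>ca\<close> become inner edges with the
        additional apex \<open>d\<close>, and \<open>cd\<close> is a new inner edge between the two
        added faces.\<close>
      have bc: "link ?P b c = {u, d}" "link ?P c b = {u, d}" "link ?P c a = {v, d}" "link ?P a c = {v, d}"
        "link ?P c d = {a, b}" "link ?P d c = {a, b}"
        using u v link_d ne link_commute[of P] unfolding link N_def by auto
      consider "{x, y} \<subseteq> {a, b, d}" | "(x, y) \<in> {(b, c), (c, b), (c, a), (a, c), (c, d), (d, c)}"
        | "x = y" | "x \<noteq> y" "\<not> {x, y} \<subseteq> {a, b, c, d}"
        by auto
      then show ?thesis
      proof cases
        case 2
        then have "link ?P x y \<in> {{u, d}, {v, d}, {a, b}}"
          unfolding insert_iff empty_iff prod.inject by (elim disjE conjE FalseE) (simp_all only: bc simp_thms)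
        then show ?thesis using uv_d ne(7) by blast
      next
        case 3
        then have "{x, y, w} \<notin> ?P" for w using card_P[of x y w] by blast
        then have "link ?P x y = {}" unfolding link_def by simp
        then show ?thesis by simp
      next
        case 4
        then have "link ?P x y = link P x y" unfolding link N_def by auto
        then show ?thesis using 4 link_inner[of x y] by auto
      qed simp
    qed
    fix j x y w assume j: "j < 6" "bdry a b d ! j = (x, y)" "{x, y, w} \<in> ?P"
    from less_6_cases[OF j(1)] j(2) have cases: "(x, y) = (a, b) \<and> j = 0 \<or> (x, y) = (b, d) \<and> j = 1 \<or> (x, y) = (d, a) \<and> j = 2 \<or>
       (x, y) = (b, a) \<and> j = 3 \<or> (x, y) = (d, b) \<and> j = 4 \<or> (x, y) = (a, d) \<and> j = 5"
      by (elim disjE) (simp_all add: bdry_def)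
    have M': "extend M ! 0 = new_label ! (M ! 0)" "extend M ! 1 = new_label ! (M ! 2)"
      "extend M ! 2 = new_label ! (M ! 5)" "extend M ! 3 = new_label ! (M ! 3)"
      "extend M ! 4 = new_label ! (M ! 1)" "extend M ! 5 = new_label ! (M ! 4)"
      by (simp_all add: extend_def old_label_def)
    \<comment> \<open>Across \<open>ab\<close> only old faces occur; the other two boundary edges
      contain \<open>d\<close>, and their only apex is \<open>c\<close>.\<close>
    have cases': "(x, y) = (a, b) \<and> j = 0 \<and> {a, b, w} \<in> P \<or> (x, y, w) = (b, d, c) \<and> j = 1 \<or>
       (x, y, w) = (d, a, c) \<and> j = 2 \<or> (x, y) = (b, a) \<and> j = 3 \<and> {b, a, w} \<in> P \<or>
       (x, y, w) = (d, b, c) \<and> j = 4 \<or> (x, y, w) = (a, d, c) \<and> j = 5"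
    proof -
      have N: "(a, b, w) \<notin> N" "(b, a, w) \<notin> N" "(b, d, w) \<in> N \<longleftrightarrow> w = c" "(d, a, w) \<in> N \<longleftrightarrow> w = c"
        "(d, b, w) \<in> N \<longleftrightarrow> w = c" "(a, d, w) \<in> N \<longleftrightarrow> w = c"
        using ne by (simp_all add: N_def)
      have P: "{b, d, w} \<notin> P" "{d, a, w} \<notin> P" "{d, b, w} \<notin> P" "{a, d, w} \<notin> P"
        using P_d by blast+
      from cases j(3) show ?thesis
        unfolding mem prod.inject by (elim disjE[of "_ \<and> _"] conjE) (simp_all only: N P simp_thms)
    qed
    have ab: "label0 (a, b, w) = 0 \<and> label0 (w, b, a) = M ! 0" if "{a, b, w} \<in> P"
      using that label_entering(1) label_leaving(1) label_old by (simp add: flags_def insert_commute)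
    have ba: "label0 (b, a, w) = 3 \<and> label0 (w, a, b) = M ! 3" if "{b, a, w} \<in> P"
      using that label_entering(4) label_leaving(4) label_old by (simp add: flags_def insert_commute)
    show "label' (x, y, w) = j"
      using cases' ab ba label_new by (auto simp: label'_def new_label_def)
    show "label' (w, y, x) = extend M ! j"
      using cases' ab ba label_new M'[unfolded One_nat_def] by (auto simp: label'_def)
  qed
  then show ?thesis by blast
qed

end

section \<open>The base case: a single triangle\<close>

lemma flags_triple:
  assumes "card {a, b, c} = 3"
  shows "flags {{a, b, c}} = {(a, b, c), (b, c, a), (c, a, b), (a, c, b), (c, b, a), (b, a, c)}"
    (is "_ = ?S")
proof (rule set_eqI)
  show "s \<in> flags {{a, b, c}} \<longleftrightarrow> s \<in> ?S" for s
    by (cases s) (simp only: flags_def mem_Collect_eq prod.case singleton_iff triple_eq_iff[OF assms])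
qed

text \<open>A single face admits no step, so its six orderings are six paths of one member each; the
  list pairs each ordering with its reversal.\<close>

lemma patch_face:
  assumes "card {a, b, c} = 3"
  shows "\<exists>label. patch {{a, b, c}} a b c [4, 5, 3, 2, 0, 1] label"
proof -
  define label where "label s = the (map_of [((a, b, c), 0), ((b, c, a), 1), ((c, a, b), 2),
     ((b, a, c), 3), ((c, b, a), 4), ((a, c, b), 5 :: nat)] s)" for s
  have ne: "a \<noteq> b" "b \<noteq> a" "b \<noteq> c" "c \<noteq> b" "a \<noteq> c" "c \<noteq> a"
    using assms unfolding card_3_distinct by auto
  have label: "label (a, b, c) = 0" "label (b, c, a) = 1" "label (c, a, b) = 2"
    "label (b, a, c) = 3" "label (c, b, a) = 4" "label (a, c, b) = 5"
    using ne by (simp_all add: label_def)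
  have link: "link {{a, b, c}} x y = {w. (x, y, w) \<in> flags {{a, b, c}}}" for x y
    by (simp add: link_def flags_def)
  have no_step: "\<not> step {{a, b, c}} s t" for s t
  proof
    assume "step {{a, b, c}} s t"
    then obtain x y z w where *: "x \<noteq> w" "{x, y, z} = {a, b, c}" "{y, z, w} = {a, b, c}"
      unfolding step_def by blast
    then have "card {x, y, z} = 3" using assms by simp
    with * show False unfolding card_3_distinct by (metis insert_iff singletonD)
  qed
  have "patch {{a, b, c}} a b c [4, 5, 3, 2, 0, 1] label"
  proof
    show "\<exists>w. link {{a, b, c}} a b = {w}" "\<exists>w. link {{a, b, c}} b c = {w}" "\<exists>w. link {{a, b, c}} c a = {w}"
      unfolding link flags_triple[OF assms] using ne by auto
    show "link {{a, b, c}} x y = {} \<or> {x, y} \<subseteq> {a, b, c} \<or>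
        (\<exists>u v. u \<noteq> v \<and> link {{a, b, c}} x y = {u, v})" for x y
      by (auto simp: link_def)
    show "label s < 6" if "s \<in> flags {{a, b, c}}" for s
      using that label unfolding flags_triple[OF assms] by auto
    show "conn {{a, b, c}} s t"
      if "s \<in> flags {{a, b, c}}" "t \<in> flags {{a, b, c}}" "label s = label t" for s t
    proof -
      have "s = t" using that label unfolding flags_triple[OF assms] by auto
      then show ?thesis by simp
    qed
    fix j x y w assume j: "j < 6" "bdry a b c ! j = (x, y)" "{x, y, w} \<in> {{a, b, c}}"
    have flag: "(x, y, w) \<in> flags {{a, b, c}}" using j(3) by (simp add: flags_def)
    have third: "(a, b, w) \<in> flags {{a, b, c}} \<longleftrightarrow> w = c" "(b, c, w) \<in> flags {{a, b, c}} \<longleftrightarrow> w = a"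
      "(c, a, w) \<in> flags {{a, b, c}} \<longleftrightarrow> w = b" "(b, a, w) \<in> flags {{a, b, c}} \<longleftrightarrow> w = c"
      "(c, b, w) \<in> flags {{a, b, c}} \<longleftrightarrow> w = a" "(a, c, w) \<in> flags {{a, b, c}} \<longleftrightarrow> w = b"
      unfolding flags_triple[OF assms] using ne by simp_all
    from less_6_cases[OF j(1)] j(2)
    have "x = a \<and> y = b \<and> j = 0 \<or> x = b \<and> y = c \<and> j = 1 \<or> x = c \<and> y = a \<and> j = 2 \<or>
      x = b \<and> y = a \<and> j = 3 \<or> x = c \<and> y = b \<and> j = 4 \<or> x = a \<and> y = c \<and> j = 5"
      by (elim disjE) (simp_all add: bdry_def)
    with flag show "label (x, y, w) = j" "label (w, y, x) = [4, 5, 3, 2, 0, 1] ! j"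
      by (elim disjE conjE; simp add: third label)+
  qed (use assms no_step in auto)
  then show ?thesis by blast
qed

text \<open>The two lists are the renamings between \<open>bdry a b c\<close> and \<open>bdry b c a\<close>.\<close>

definition rot :: "nat list \<Rightarrow> nat list" where
  "rot M = map (\<lambda>j. [2, 0, 1, 5, 3, 4] ! (M ! ([1, 2, 0, 4, 5, 3] ! j))) [0..<6]"

section \<open>Rotating the boundary and renaming vertices\<close>

context patch
begin

lemma patch_rotate: "patch P b c a (rot M) (\<lambda>s. [2, 0, 1, 5, 3, 4] ! label s)"
proof
  have inj: "inj_on ((!) [2, 0, 1, 5, 3, 4 :: nat]) {..<6}"
    by (auto simp: inj_on_def dest!: less_6_cases)
  show "card {b, c, a} = 3" using card_bdry by (simp add: insert_commute)
  show "[2, 0, 1, 5, 3, 4] ! label s < (6 :: nat)" if "s \<in> flags P" for s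
    using less_6_cases[OF label_less[OF that]] by auto
  show "conn P s t" if "s \<in> flags P" "t \<in> flags P"
    "[2, 0, 1, 5, 3, 4 :: nat] ! label s = [2, 0, 1, 5, 3, 4] ! label t" for s t
    using inj_onD[OF inj that(3)] label_less label_conn that by simp
  show "link P x y = {} \<or> {x, y} \<subseteq> {b, c, a} \<or> (\<exists>u v. u \<noteq> v \<and> link P x y = {u, v})" for x y
    using link_inner[of x y] by (simp add: insert_commute)
  fix j x y w assume j: "j < 6" "bdry b c a ! j = (x, y)" "{x, y, w} \<in> P"
  \<comment> \<open>\<open>i\<close> is the position in \<open>bdry a b c\<close> of the
    \<open>j\<close>-th directed edge of \<open>bdry b c a\<close>.\<close>
  define i where "i = [1, 2, 0, 4, 5, 3 :: nat] ! j"
  have i: "i < 6" "bdry a b c ! i = (x, y)" "[2, 0, 1, 5, 3, 4] ! i = j" "rot M ! j = [2, 0, 1, 5, 3, 4] ! (M ! i)"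
    using j(1,2) by (auto simp: bdry_def i_def rot_def dest!: less_6_cases)
  show "[2, 0, 1, 5, 3, 4] ! label (x, y, w) = j" using label_in[OF i(1,2) j(3)] i(3) by simp
  show "[2, 0, 1, 5, 3, 4] ! label (w, y, x) = rot M ! j" using label_out[OF i(1,2) j(3)] i(4) by simp
qed (use finite_faces card_face link_bdry label_step in auto)

text \<open>This serves the identification of vertices in a connected sum. A renaming injective on
  the vertices of \<open>P\<close> preserves faces and steps in both directions; labels are carried
  along its inverse \<open>q\<close>.\<close>

lemma patch_image:
  assumes inj: "inj_on r (\<Union>P)"
  shows "\<exists>label'. patch ((`) r ` P) (r a) (r b) (r c) M label'"
proof -
  let ?P = "(`) r ` P" and ?r = "map_prod r (map_prod r r)"
  define q where "q = inv_into (\<Union>P) r"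
  let ?q = "map_prod q (map_prod q q)"
  have q: "q (r x) = x" if "x \<in> \<Union>P" for x using inj that by (simp add: q_def)
  have mem: "{x, y, z} \<in> ?P \<longleftrightarrow> (\<exists>x' y' z'. x = r x' \<and> y = r y' \<and> z = r z' \<and> {x', y', z'} \<in> P)" for x y z
  proof
    assume "{x, y, z} \<in> ?P"
    then obtain F where F: "F \<in> P" "{x, y, z} = r ` F" by auto
    then have "x \<in> r ` F" "y \<in> r ` F" "z \<in> r ` F" by auto
    then obtain x' y' z' where *: "x = r x'" "y = r y'" "z = r z'" "x' \<in> F" "y' \<in> F" "z' \<in> F"
      by blast
    have "r ` {x', y', z'} = r ` F" using F(2) * by simp
    moreover have "{x', y', z'} \<subseteq> \<Union>P" "F \<subseteq> \<Union>P" using * F(1) by auto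
    ultimately have "{x', y', z'} = F" using inj by (metis inj_on_image_eq_iff)
    then show "\<exists>x' y' z'. x = r x' \<and> y = r y' \<and> z = r z' \<and> {x', y', z'} \<in> P"
      using * F(1) by blast
  next
    assume "\<exists>x' y' z'. x = r x' \<and> y = r y' \<and> z = r z' \<and> {x', y', z'} \<in> P"
    then obtain x' y' z' where "{x, y, z} = r ` {x', y', z'}" "{x', y', z'} \<in> P" by auto
    then show "{x, y, z} \<in> ?P" by blast
  qed
  have q_face: "{x, y, z} \<in> P \<Longrightarrow> q (r x) = x \<and> q (r y) = y \<and> q (r z) = z" for x y z
    using q by blast
  have link: "link ?P (r x) (r y) = r ` link P x y" if "x \<in> \<Union>P" "y \<in> \<Union>P" for x y
  proof (intro set_eqI iffI)
    fix w assume "w \<in> link ?P (r x) (r y)"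
    then obtain x' y' z' where *: "r x = r x'" "r y = r y'" "w = r z'" "{x', y', z'} \<in> P"
      by (auto simp: link_def mem)
    then have "x' = x" "y' = y" using inj_onD[OF inj] that by blast+
    with * show "w \<in> r ` link P x y" by (auto simp: link_def)
  next
    fix w assume "w \<in> r ` link P x y"
    then show "w \<in> link ?P (r x) (r y)" by (auto simp: link_def mem)
  qed
  have step_r: "step ?P (?r s) (?r t)" if "step P s t" for s t
  proof -
    obtain x y z w where *: "s = (x, y, z)" "t = (y, z, w)" "x \<noteq> w" "{x, y, z} \<in> P" "{y, z, w} \<in> P"
      using \<open>step P s t\<close> unfolding step_def by blast
    moreover have "r x \<noteq> r w" using * q_face by metis
    ultimately show ?thesis by (auto simp: step_def mem)
  qed
  have step_q: "step P (?q s) (?q t)" if "step ?P s t" for s t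
  proof -
    obtain x y z w where *: "s = (x, y, z)" "t = (y, z, w)" "x \<noteq> w" "{x, y, z} \<in> ?P" "{y, z, w} \<in> ?P"
      using \<open>step ?P s t\<close> unfolding step_def by blast
    from *(4) obtain x' y' z' where 1: "x = r x'" "y = r y'" "z = r z'" "{x', y', z'} \<in> P"
      unfolding mem by blast
    from *(5) obtain y'' z'' w' where 2: "y = r y''" "z = r z''" "w = r w'" "{y'', z'', w'} \<in> P"
      unfolding mem by blast
    have "q x = x'" "q y = y'" "q z = z'" "q y = y''" "q z = z''" "q w = w'"
      using q_face[OF 1(4)] q_face[OF 2(4)] 1 2 by simp_all
    then show ?thesis using * 1 2 by (auto simp: step_def)
  qed
  have conn_r: "conn ?P (?r s) (?r t)" if "conn P s t" for s t
    using that
  proof (induction rule: equivclp_induct)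
    case (step y z)
    then show ?case using step_r by (meson equivclp_into_equivclp)
  qed simp
  have flags_q: "?q s \<in> flags P \<and> ?r (?q s) = s" if "s \<in> flags ?P" for s
  proof -
    obtain x y z where s: "s = (x, y, z)" "{x, y, z} \<in> ?P"
      using \<open>s \<in> flags ?P\<close> unfolding flags_def by blast
    then show ?thesis unfolding mem using q_face by (auto simp: flags_def)
  qed
  have "patch ?P (r a) (r b) (r c) M (label \<circ> ?q)"
  proof
    show "finite ?P" using finite_faces by simp
    show "card F = 3" if "F \<in> ?P" for F
    proof -
      obtain G where "G \<in> P" "F = r ` G" using \<open>F \<in> ?P\<close> by blast
      moreover then have "inj_on r G" using inj by (auto intro: inj_on_subset)
      ultimately show ?thesis using card_face card_image by metis
    qed
    have "inj_on r {a, b, c}" by (rule inj_on_subset[OF inj]) (use bdry_Union in blast)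
    then have "card (r ` {a, b, c}) = 3" using card_bdry card_image by metis
    then show "card {r a, r b, r c} = 3" by simp
    show "\<exists>w. link ?P (r a) (r b) = {w}" "\<exists>w. link ?P (r b) (r c) = {w}" "\<exists>w. link ?P (r c) (r a) = {w}"
      unfolding link[OF bdry_Union(1,2)] link[OF bdry_Union(2,3)] link[OF bdry_Union(3,1)]
      using link_bdry by auto
    show "(label \<circ> ?q) s < 6" if "s \<in> flags ?P" for s
      using label_less flags_q[OF that] by simp
    show "(label \<circ> ?q) s = (label \<circ> ?q) t" if "step ?P s t" for s t
      using label_step[OF step_q[OF that]] by simp
    show "conn ?P s t" if "s \<in> flags ?P" "t \<in> flags ?P" "(label \<circ> ?q) s = (label \<circ> ?q) t" for s t
      using conn_r[OF label_conn[of "?q s" "?q t"]] flags_q that by simp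
    show "link ?P x y = {} \<or> {x, y} \<subseteq> {r a, r b, r c} \<or> (\<exists>u v. u \<noteq> v \<and> link ?P x y = {u, v})" for x y
    proof (cases "link ?P x y = {}")
      case False
      then obtain x' y' where xy: "x = r x'" "y = r y'" "x' \<in> \<Union>P" "y' \<in> \<Union>P"
        unfolding link_def mem by blast
      from link_inner[of x' y'] show ?thesis
      proof (elim disjE exE conjE)
        fix u v assume uv: "u \<noteq> v" "link P x' y' = {u, v}"
        then have "u \<in> \<Union>P" "v \<in> \<Union>P" unfolding link_def by blast+
        then have "r u \<noteq> r v" using uv(1) q by metis
        then show ?thesis using link[OF xy(3,4)] uv xy by auto
      qed (use link[OF xy(3,4)] xy in auto)
    qed simp
    fix j x y w assume j: "j < 6" "bdry (r a) (r b) (r c) ! j = (x, y)" "{x, y, w} \<in> ?P"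
    obtain x' y' where xy: "bdry a b c ! j = (x', y')" by (cases "bdry a b c ! j")
    have "x = r x'" "y = r y'" "x' \<in> {a, b, c}" "y' \<in> {a, b, c}"
      using j(1,2) xy by (auto simp: bdry_def dest!: less_6_cases)
    moreover then have "x' \<in> \<Union>P" "y' \<in> \<Union>P" using bdry_Union by auto
    moreover obtain x'' y'' w' where w: "x = r x''" "y = r y''" "w = r w'" "{x'', y'', w'} \<in> P"
      using j(3) unfolding mem by blast
    ultimately have *: "q x = x'" "q y = y'" "q w = w'" "{x', y', w'} \<in> P"
      using q_face[OF w(4)] q by metis+
    show "(label \<circ> ?q) (x, y, w) = j" using label_in[OF j(1) xy *(4)] * by simp
    show "(label \<circ> ?q) (w, y, x) = M ! j" using label_out[OF j(1) xy *(4)] * by simp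
  qed
  then show ?thesis by blast
qed

end

section \<open>Closing the removed face\<close>

text \<open>The 5 * 3 * 1 = 15 fixed-point-free involutions of six elements, in lexicographic
  order.\<close>

definition matchings :: "nat list list" where
  "matchings =
    [[1,0,3,2,5,4], [1,0,4,5,2,3], [1,0,5,4,3,2], [2,3,0,1,5,4], [2,4,0,5,1,3],
     [2,5,0,4,3,1], [3,2,1,0,5,4], [3,4,5,0,1,2], [3,5,4,0,2,1], [4,2,1,5,0,3],
     [4,3,5,1,0,2], [4,5,3,2,0,1], [5,2,1,4,3,0], [5,3,4,1,2,0], [5,4,3,2,1,0]]"

text \<open>
  The removed face joins a path leaving along the reverse of edge \<open>i\<close> to the path entering through
  edge \<open>bdry_matching ! i\<close>, so \<open>walk M\<close> is the passage from one path to the next along a zigzag.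
\<close>

definition bdry_matching :: "nat list" where
  "bdry_matching = [5,3,4,1,2,0]"

definition walk :: "nat list \<Rightarrow> nat \<Rightarrow> nat" where
  "walk M j = bdry_matching ! (M ! j)"

text \<open>Six iterates exhaust an orbit of a permutation of six elements; the bounded list makes
  it executable.\<close>

definition cycle :: "nat list \<Rightarrow> nat \<Rightarrow> nat set" where
  "cycle M j = set (map (\<lambda>k. (walk M ^^ k) j) [0..<6])"

text \<open>Since \<open>M\<close> is an involution, \<open>walk M\<close> takes
  \<open>M ! j\<close> to \<open>bdry_matching ! j\<close>; the fifteen matchings are checked by
  evaluation.\<close>

lemma cycle_match:
  assumes "M \<in> set matchings" "j < 6"
  shows "cycle M (M ! j) = cycle M (bdry_matching ! j)"
proof -
  have "\<forall>M\<in>set matchings. \<forall>j\<in>set [0..<6]. cycle M (M ! j) = cycle M (bdry_matching ! j)"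
    by code_simp
  with assms show ?thesis by auto
qed

text \<open>These orbits are oriented: a cycle in the union of the two matchings splits into two of
  them, one for each direction of a zigzag.\<close>

definition num_cycles :: "nat list \<Rightarrow> nat" where
  "num_cycles M = card (cycle M ` {..<6})"


lemma matching_involution:
  assumes "M \<in> set matchings" "j < 6"
  shows "M ! j < 6" "M ! (M ! j) = j"
proof -
  have "\<forall>M\<in>set matchings. \<forall>j\<in>set [0..<6]. M ! j < 6 \<and> M ! (M ! j) = j"
    by code_simp
  with assms show "M ! j < 6" "M ! (M ! j) = j" by auto
qed

section \<open>Counting zigzags of the closed surface\<close>

context patch
begin

text \<open>Each boundary edge has one face in \<open>P\<close> and gains \<open>abc\<close> as its
  second. The hypothesis makes the two distinct; it excludes the patch consisting of
  \<open>abc\<close> alone.\<close>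

lemma closed_surface_insert:
  assumes "{a, b, c} \<notin> P"
  shows "closed_surface (insert {a, b, c} P)"
proof
  let ?G = "insert {a, b, c} P"
  show "finite ?G" using finite_faces by simp
  show card: "card F = 3" if "F \<in> ?G" for F using that card_face card_bdry by auto
  fix x y z assume xyz: "{x, y, z} \<in> ?G"
  then have ne: "x \<noteq> y" "y \<noteq> z" "x \<noteq> z" using card card_3_distinct by metis+
  have "\<exists>u v. u \<noteq> v \<and> link ?G y z = {u, v}"
  proof (cases "{y, z} \<subseteq> {a, b, c}")
    case True
    then obtain t where t: "{y, z, t} = {a, b, c}"
      using ne(2) by (auto simp: insert_commute)
    have "\<exists>w. link P y z = {w}"
    proof -
      have "(y, z) \<in> {(a, b), (b, c), (c, a), (b, a), (c, b), (a, c)}" using True ne(2) by auto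
      then show ?thesis using link_bdry link_commute[of P] by auto
    qed
    then obtain w where w: "link P y z = {w}" by blast
    have "link ?G y z = {w' . {y, z, w'} = {y, z, t}} \<union> {w}"
      using w t by (auto simp: link_def)
    moreover have "{w' . {y, z, w'} = {y, z, t}} = {t}"
    proof -
      have "card {y, z, t} = 3" using t card_bdry by simp
      then have "t \<noteq> y" "t \<noteq> z" unfolding card_3_distinct by auto
      then show ?thesis by auto
    qed
    \<comment> \<open>If the apexes coincided, the closing face would already belong to
      \<open>P\<close>.\<close>
    moreover have "t \<noteq> w"
    proof -
      have "w \<in> link P y z" using w by simp
      then show ?thesis using assms t by (auto simp: link_def)
    qed
    ultimately show ?thesis by blast
  next
    case False
    then have "link ?G y z = link P y z" by (auto simp: link_def)
    moreover have "x \<in> link ?G y z" using xyz by (simp add: link_def insert_commute)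
    ultimately show ?thesis using link_inner[of y z] False by auto
  qed
  moreover have "x \<in> link ?G y z" using xyz by (simp add: link_def insert_commute)
  ultimately have "\<exists>!w. x \<noteq> w \<and> w \<in> link ?G y z" by auto
  then show "\<exists>!w. x \<noteq> w \<and> {y, z, w} \<in> ?G" by (simp add: link_def)
qed

text \<open>The \<open>walk M\<close>-orbit of the path label is a complete invariant of ordered
  faces in the closed surface, so \<open>card_zigzags\<close> counts these orbits.\<close>

lemma card_zigzags_insert:
  assumes new: "{a, b, c} \<notin> P" and M: "M \<in> set matchings"
  shows "finite (zigzags (insert {a, b, c} P))"
    and "card (zigzags (insert {a, b, c} P)) = num_cycles M"
proof -
  let ?G = "insert {a, b, c} P"
  interpret G: closed_surface ?G by (rule closed_surface_insert[OF new])
  note ne = distinct_bdry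
  define N where "N = {(a, b, c), (b, c, a), (c, a, b), (b, a, c), (c, b, a), (a, c, b)}"
  \<comment> \<open>An ordering of the closing face is labelled by the path that follows it.\<close>
  define lab where "lab = map_of
    [((a, b, c), 1), ((b, c, a), 2), ((c, a, b), 0), ((b, a, c), 5), ((c, b, a), 3), ((a, c, b), 4 :: nat)]"
  define label0 where "label0 s = (case lab s of None \<Rightarrow> label s | Some l \<Rightarrow> l)" for s
  have mem: "{x, y, z} \<in> ?G \<longleftrightarrow> {x, y, z} \<in> P \<or> (x, y, z) \<in> N" for x y z
    unfolding insert_iff triple_eq_iff[OF card_bdry] N_def
    by (simp only: insert_iff empty_iff simp_thms disj_ac)
  have flags: "flags ?G = flags P \<union> N"
    unfolding flags_def mem by blast
  have N_P: "s \<notin> flags P" if "s \<in> N" for s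
  proof -
    obtain x y z where s: "s = (x, y, z)" by (cases s)
    then have "{x, y, z} = {a, b, c}"
      using that unfolding triple_eq_iff[OF card_bdry] N_def by (simp only: insert_iff empty_iff simp_thms disj_ac)
    then show ?thesis using new s by (simp add: flags_def)
  qed
  have label_old: "label0 s = label s" if "s \<in> flags P" for s
  proof -
    have "s \<notin> N" using N_P that by blast
    moreover have "dom lab = N"
      unfolding lab_def dom_map_of_conv_image_fst N_def
      by (simp only: list.set image_insert image_empty fst_conv)
    ultimately have "lab s = None" by blast
    then show ?thesis by (simp add: label0_def)
  qed
  have label_new: "label0 (a, b, c) = 1" "label0 (b, c, a) = 2" "label0 (c, a, b) = 0"
    "label0 (b, a, c) = 5" "label0 (c, b, a) = 3" "label0 (a, c, b) = 4"
    using ne by (simp_all add: label0_def lab_def)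
  have cyc: "cycle M (M ! 0) = cycle M 5" "cycle M (M ! 1) = cycle M 3" "cycle M (M ! 2) = cycle M 4"
     "cycle M (M ! 3) = cycle M 1" "cycle M (M ! 4) = cycle M 2" "cycle M (M ! 5) = cycle M 0"
    using cycle_match[OF M] by (simp_all add: bdry_matching_def)
  have old: "(x, y, z) \<in> flags P \<longleftrightarrow> {x, y, z} \<in> P" for x y z by (simp add: flags_def)
  have inv: "cycle M (label0 s) = cycle M (label0 s')" if st: "step ?G s s'" for s s'
  proof -
    obtain x y z w where s: "s = (x, y, z)" "s' = (y, z, w)" "x \<noteq> w"
      "{x, y, z} \<in> ?G" "{y, z, w} \<in> ?G"
      using st unfolding step_def by blast
    consider "{x, y, z} \<in> P" "{y, z, w} \<in> P" | "{x, y, z} \<in> P" "(y, z, w) \<in> N"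
      | "(x, y, z) \<in> N" "{y, z, w} \<in> P" | "(x, y, z) \<in> N" "(y, z, w) \<in> N"
      using s(4,5) unfolding mem by blast
    then show ?thesis
    proof cases
      case 1
      then have "step P s s'" using s by (simp add: step_def)
      then show ?thesis using label_step label_old 1 s by (simp add: flags_def)
    next
      case 2
      have "label0 s = label s" using label_old s 2 by (simp add: flags_def)
      \<comment> \<open>Where a path runs into the closing face the label changes, but by
        \<open>cyc\<close> it stays in the same \<open>cycle\<close>.\<close>
      with 2 show ?thesis
        unfolding N_def s(1,2) insert_iff empty_iff prod.inject
        by (elim disjE conjE FalseE) (simp_all only: label_new label_entering label_leaving cyc)
    next
      case 3
      have "label0 s' = label s'" using label_old s 3 by (simp add: flags_def)
      with 3 show ?thesis
        unfolding N_def s(1,2) insert_iff empty_iff prod.inject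
        by (elim disjE conjE FalseE) (simp_all only: label_new label_entering label_leaving)
    next
      case 4
      then have "{x, y, z} = {a, b, c}" "{y, z, w} = {a, b, c}"
        unfolding triple_eq_iff[OF card_bdry] N_def by (simp_all only: insert_iff empty_iff simp_thms disj_ac)
      moreover then have "card {x, y, z} = 3" using card_bdry by simp
      ultimately show ?thesis using s(3) unfolding card_3_distinct by (metis insert_iff singletonD)
    qed
  qed
  obtain u where u: "link P a b = {u}" using link_bdry by blast
  obtain v where v: "link P b c = {v}" using link_bdry by blast
  obtain t where t: "link P c a = {t}" using link_bdry by blast
  have uvt: "{a, b, u} \<in> P" "{b, a, u} \<in> P" "{b, c, v} \<in> P" "{c, b, v} \<in> P" "{c, a, t} \<in> P" "{a, c, t} \<in> P"
    "{u, a, b} \<in> P" "{u, b, a} \<in> P" "{v, b, c} \<in> P" "{v, c, b} \<in> P" "{t, a, c} \<in> P" "{t, c, a} \<in> P"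
    using u v t by (auto simp: link_def insert_commute)
  have uvt_ne: "u \<noteq> c" "v \<noteq> a" "t \<noteq> b"
    using uvt new by (auto simp: insert_commute)
  have Ns: "(a, b, c) \<in> N" "(b, c, a) \<in> N" "(c, a, b) \<in> N" "(b, a, c) \<in> N" "(c, b, a) \<in> N" "(a, c, b) \<in> N"
    by (simp_all add: N_def)
  have st: "step ?G (u, a, b) (a, b, c)" "step ?G (a, b, c) (b, c, v)"
    "step ?G (v, b, c) (b, c, a)" "step ?G (b, c, a) (c, a, t)"
    "step ?G (t, c, a) (c, a, b)" "step ?G (c, a, b) (a, b, u)"
    "step ?G (u, b, a) (b, a, c)" "step ?G (b, a, c) (a, c, t)"
    "step ?G (v, c, b) (c, b, a)" "step ?G (c, b, a) (b, a, u)"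
    "step ?G (t, a, c) (a, c, b)" "step ?G (a, c, b) (c, b, v)"
    unfolding step_def split mem using Ns uvt uvt_ne by blast+
  have fl: "(a, b, u) \<in> flags P" "(b, a, u) \<in> flags P" "(b, c, v) \<in> flags P" "(c, b, v) \<in> flags P"
    "(c, a, t) \<in> flags P" "(a, c, t) \<in> flags P" "(u, a, b) \<in> flags P" "(u, b, a) \<in> flags P"
    "(v, b, c) \<in> flags P" "(v, c, b) \<in> flags P" "(t, a, c) \<in> flags P" "(t, c, a) \<in> flags P"
    using uvt unfolding old by blast+
  \<comment> \<open>Each ordering of the closing face links the end \<open>p\<close> of one path to
    the start \<open>q\<close> of the next.\<close>
  let ?attached = "\<lambda>s. \<exists>p\<in>flags P. \<exists>q\<in>flags P. conn ?G p s \<and> conn ?G s q \<and> label q = label0 s \<and>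
      label p = M ! (bdry_matching ! label0 s)"
  have attachI: "?attached s" if "step ?G p s" "step ?G s q" "p \<in> flags P" "q \<in> flags P"
    "label q = label0 s" "label p = M ! (bdry_matching ! label0 s)" for p q s
    using that by (meson r_into_equivclp)
  have attach: "?attached s" if "s \<in> N" for s
    using that unfolding N_def
  proof (elim insertE emptyE; hypsubst)
    show "?attached (a, b, c)"
      by (rule attachI[OF st(1,2)])
        (use fl uvt in \<open>simp_all add: label_entering label_leaving label_new bdry_matching_def\<close>)
    show "?attached (b, c, a)"
      by (rule attachI[OF st(3,4)])
        (use fl uvt in \<open>simp_all add: label_entering label_leaving label_new bdry_matching_def\<close>)
    show "?attached (c, a, b)"
      by (rule attachI[OF st(5,6)])
        (use fl uvt in \<open>simp_all add: label_entering label_leaving label_new bdry_matching_def\<close>)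
    show "?attached (b, a, c)"
      by (rule attachI[OF st(7,8)])
        (use fl uvt in \<open>simp_all add: label_entering label_leaving label_new bdry_matching_def\<close>)
    show "?attached (c, b, a)"
      by (rule attachI[OF st(9,10)])
        (use fl uvt in \<open>simp_all add: label_entering label_leaving label_new bdry_matching_def\<close>)
    show "?attached (a, c, b)"
      by (rule attachI[OF st(11,12)])
        (use fl uvt in \<open>simp_all add: label_entering label_leaving label_new bdry_matching_def\<close>)
  qed
  have label0_N: "\<exists>s\<in>N. label0 s = l" if "l < 6" for l
    using less_6_cases[OF that] Ns label_new by metis
  have conn_P: "conn ?G s s'" if "s \<in> flags P" "s' \<in> flags P" "label s = label s'" for s s'
    using conn_mono[OF _ label_conn[OF that]] by blast
  have conn_walk: "\<exists>s'\<in>flags P. conn ?G s s' \<and> label s' = walk M (label s)" if s: "s \<in> flags P" for s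
  proof -
    let ?j = "M ! label s"
    have j: "?j < 6" "M ! ?j = label s" using matching_involution[OF M label_less[OF s]] by auto
    have \<beta>: "bdry_matching \<in> set matchings" by (simp add: bdry_matching_def matchings_def)
    \<comment> \<open>\<open>n\<close> is chosen such that the path before it is the one of
      \<open>s\<close>: both involutions cancel in the label of \<open>p\<close>.\<close>
    from label0_N matching_involution(1)[OF \<beta> j(1)]
    obtain n where n: "n \<in> N" "label0 n = bdry_matching ! ?j" by blast
    from attach[OF n(1)] obtain p q where pq: "p \<in> flags P" "q \<in> flags P" "conn ?G p n" "conn ?G n q"
      "label q = walk M (label s)" "label p = M ! (bdry_matching ! (bdry_matching ! ?j))"
      unfolding n(2) walk_def by blast
    then have "label s = label p" using matching_involution(2)[OF \<beta> j(1)] j(2) by simp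
    then have "conn ?G s p" using conn_P s pq(1) by blast
    then have "conn ?G s q" using pq(3,4) by (meson equivclp_trans)
    with pq show ?thesis by blast
  qed
  have conn_walks: "\<exists>s'\<in>flags P. conn ?G s s' \<and> label s' = (walk M ^^ k) (label s)"
    if s: "s \<in> flags P" for s k
  proof (induction k)
    case 0
    then show ?case using s by (intro bexI[of _ s]) auto
  next
    case (Suc k)
    then obtain s' where s': "s' \<in> flags P" "conn ?G s s'" "label s' = (walk M ^^ k) (label s)" by blast
    from conn_walk[OF s'(1)] obtain s'' where "s'' \<in> flags P" "conn ?G s' s''"
      "label s'' = walk M (label s')" by blast
    with s' show ?case by (intro bexI[of _ s'']) (auto intro: equivclp_trans)
  qed
  have attach_old: "\<exists>s'\<in>flags P. conn ?G s s' \<and> label s' = label0 s" if "s \<in> flags ?G" for s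
  proof (cases "s \<in> N")
    case True
    from attach[OF this] show ?thesis by blast
  next
    case False
    then have "s \<in> flags P" using that unfolding flags by blast
    then show ?thesis using label_old by (intro bexI[of _ s]) auto
  qed
  have conn: "conn ?G s s'" if *: "s \<in> flags ?G" "s' \<in> flags ?G" "cycle M (label0 s) = cycle M (label0 s')"
    for s s'
  proof -
    obtain r where r: "r \<in> flags P" "conn ?G s r" "label r = label0 s" using attach_old[OF *(1)] by blast
    obtain r' where r': "r' \<in> flags P" "conn ?G s' r'" "label r' = label0 s'"
      using attach_old[OF *(2)] by blast
    have "label r' \<in> cycle M (label r')"
      unfolding cycle_def set_map by (rule image_eqI[of _ _ 0]) simp_all
    also have "\<dots> = cycle M (label r)" using * r r' by simp
    finally obtain k where "label r' = (walk M ^^ k) (label r)" unfolding cycle_def set_map by blast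
    with conn_walks[OF r(1), of k] obtain p where p: "p \<in> flags P" "conn ?G r p" "label p = label r'"
      by auto
    then have "conn ?G p r'" using conn_P r'(1) by blast
    with p(2) r(2) r'(2) show ?thesis by (meson equivclp_trans equivclp_sym)
  qed
  have "label0 ` flags ?G = {..<6}"
  proof
    show "label0 ` flags ?G \<subseteq> {..<6}" using attach_old label_less by (metis image_subsetI lessThan_iff)
    show "{..<6} \<subseteq> label0 ` flags ?G" using label0_N unfolding flags by blast
  qed
  then have img: "(\<lambda>s. cycle M (label0 s)) ` flags ?G = cycle M ` {..<6}"
    unfolding image_image[of "cycle M" label0, symmetric] by simp
  show "finite (zigzags ?G)"
    by (rule G.card_zigzags(1)[of "\<lambda>s. cycle M (label0 s)", OF inv conn])
  have "card (zigzags ?G) = card ((\<lambda>s. cycle M (label0 s)) ` flags ?G)"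
    by (rule G.card_zigzags(2)[of "\<lambda>s. cycle M (label0 s)", OF inv conn])
  then show "card (zigzags ?G) = num_cycles M" unfolding img num_cycles_def .
qed

end

section \<open>Types of faces in a tetrahedral chain\<close>

text \<open>
  The types number the seven classes of \<open>matchings\<close> under \<open>rot\<close>; type 0 is the class of
  \<open>bdry_matching\<close>, which belongs to the tetrahedron.
\<close>

definition matching_type :: "nat list \<Rightarrow> nat" where
  "matching_type M = the (map_of (zip matchings [1, 2, 3, 2, 3, 1, 3, 5, 4, 1, 4, 6, 2, 0, 4]) M)"

definition type_zigzags :: "nat \<Rightarrow> nat" where
  "type_zigzags t = [3, 1, 2, 1, 2, 1, 1] ! t"

text \<open>Sorted triples stand for multisets of types of the three new faces. With weight 1/3 per
  entry they are the rows of the transition matrix.\<close>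

definition next_types :: "nat \<Rightarrow> nat list" where
  "next_types t = [[1, 1, 1], [2, 4, 4], [3, 3, 6], [1, 1, 5], [2, 2, 4], [3, 3, 3], [0, 0, 0]] ! t"

lemma matching_type:
  assumes "M \<in> set matchings"
  shows "num_cycles M = 2 * type_zigzags (matching_type M)" "matching_type M < 7"
proof -
  have "\<forall>M\<in>set matchings. card (set (map (cycle M) [0..<6])) = 2 * type_zigzags (matching_type M) \<and>
     matching_type M < 7"
    by code_simp
  with assms show "num_cycles M = 2 * type_zigzags (matching_type M)" "matching_type M < 7"
    by (auto simp: num_cycles_def atLeast0LessThan)
qed

text \<open>Rotating the boundary before \<open>extend\<close> selects which of the three new faces
  is removed next; sorting forgets which rotation gave which type.\<close>

lemma extend_matching:
  assumes "M \<in> set matchings"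
  shows "rot M \<in> set matchings" "extend M \<in> set matchings"
    and "sort (map matching_type [extend M, extend (rot M), extend (rot (rot M))]) =
      next_types (matching_type M)"
proof -
  have "\<forall>M\<in>set matchings. rot M \<in> set matchings \<and> extend M \<in> set matchings \<and>
     sort (map matching_type [extend M, extend (rot M), extend (rot (rot M))]) =
      next_types (matching_type M)"
    by code_simp
  with assms show "rot M \<in> set matchings" "extend M \<in> set matchings"
    "sort (map matching_type [extend M, extend (rot M), extend (rot (rot M))]) =
      next_types (matching_type M)"
    by auto
qed

text \<open>A relation, because a face has several orderings and each might a priori yield its own
  matching.\<close>

definition face_type :: "'a set set \<Rightarrow> 'a set \<Rightarrow> nat \<Rightarrow> bool" where
  "face_type \<Gamma> F t \<longleftrightarrow> F \<in> \<Gamma> \<and> (\<exists>a b c M lab. F = {a, b, c} \<and> patch (\<Gamma> - {F}) a b c M lab \<and>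
     M \<in> set matchings \<and> t = matching_type M)"

lemma face_type_less: "face_type \<Gamma> F t \<Longrightarrow> t < 7"
  unfolding face_type_def using matching_type(2) by blast

text \<open>Putting \<open>F\<close> back restores \<open>\<Gamma>\<close>, so the type of one face
  determines the zigzag count of the whole triangulation.\<close>

lemma face_type_zigzags:
  assumes "face_type \<Gamma> F t"
  shows "has_zigzags_up_to_reversing \<Gamma> k \<longleftrightarrow> type_zigzags t = k"
proof -
  obtain a b c M lab where *: "F \<in> \<Gamma>" "F = {a, b, c}" "patch (\<Gamma> - {F}) a b c M lab"
    "M \<in> set matchings" "t = matching_type M"
    using assms unfolding face_type_def by blast
  interpret patch "\<Gamma> - {F}" a b c M lab by fact
  have eq: "insert {a, b, c} (\<Gamma> - {F}) = \<Gamma>" using *(1,2) by blast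
  have "{a, b, c} \<notin> \<Gamma> - {F}" using *(2) by simp
  from card_zigzags_insert[OF this *(4)] show ?thesis
    unfolding eq has_zigzags_up_to_reversing_def matching_type(1)[OF *(4)] *(5) by auto
qed

lemma face_type_extend:
  assumes P: "patch P a b c M lab" and M: "M \<in> set matchings" and d: "d \<notin> \<Union>P"
  shows "face_type (P \<union> {{a, b, d}, {b, c, d}, {c, a, d}}) {a, b, d} (matching_type (extend M))"
proof -
  interpret patch P a b c M lab by fact
  let ?G = "P \<union> {{a, b, d}, {b, c, d}, {c, a, d}}"
  obtain lab' where lab': "patch (P \<union> {{b, c, d}, {c, a, d}}) a b d (extend M) lab'"
    using patch_extend[OF d matching_involution(1)[OF M]] by blast
  have "d \<noteq> a" "d \<noteq> b" "d \<noteq> c" using d bdry_Union by blast+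
  then have "a \<notin> {b, c, d}" "b \<notin> {c, a, d}" "{a, b, d} \<notin> P"
    using distinct_bdry d by blast+
  then have "?G - {{a, b, d}} = P \<union> {{b, c, d}, {c, a, d}}" by blast
  then have "patch (?G - {{a, b, d}}) a b d (extend M) lab'" using lab' by simp
  moreover have "{a, b, d} \<in> ?G" by simp
  ultimately show ?thesis using extend_matching(2)[OF M] unfolding face_type_def by blast
qed

lemma tetrahedron_faces:
  assumes "tetrahedron T" "{a, b, c} \<in> T"
  obtains d where "d \<notin> {a, b, c}" "T = {{a, b, c}, {a, b, d}, {b, c, d}, {c, a, d}}"
    "card {a, b, c} = 3"
proof -
  obtain V where V: "card V = 4" "T = {F. F \<subseteq> V \<and> card F = 3}"
    using assms(1) by (auto simp: tetrahedron_def)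
  have F: "{a, b, c} \<subseteq> V" "card {a, b, c} = 3" using assms(2) V(2) by auto
  have "card (V - {a, b, c}) = 1" using V(1) F by (subst card_Diff_subset) auto
  then obtain d where "V - {a, b, c} = {d}" by (auto simp: card_1_singleton_iff)
  then have d: "d \<notin> {a, b, c}" "V = {a, b, c, d}" using F(1) by blast+
  have ne: "a \<noteq> b" "b \<noteq> c" "a \<noteq> c" "d \<noteq> a" "d \<noteq> b" "d \<noteq> c"
    using F(2) d(1) unfolding card_3_distinct by auto
  have "F \<in> T \<longleftrightarrow> (\<exists>v\<in>V. F = V - {v})" for F
  proof
    assume "F \<in> T"
    then have F: "F \<subseteq> V" "card F = 3" using V(2) by auto
    then have "card (V - F) = 1" using V(1) by (subst card_Diff_subset) (auto intro: card_ge_0_finite)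
    then obtain v where "V - F = {v}" by (auto simp: card_1_singleton_iff)
    with F(1) show "\<exists>v\<in>V. F = V - {v}" by blast
  next
    assume "\<exists>v\<in>V. F = V - {v}"
    then show "F \<in> T" using V by auto
  qed
  then have "T = (\<lambda>v. V - {v}) ` {a, b, c, d}" unfolding d(2) by blast
  moreover have "V - {a} = {b, c, d}" "V - {b} = {c, a, d}" "V - {c} = {a, b, d}" "V - {d} = {a, b, c}"
    unfolding d(2) using ne by auto
  ultimately have "T = {{a, b, c}, {a, b, d}, {b, c, d}, {c, a, d}}"
    by (simp add: insert_commute)
  from d(1) this F(2) show thesis by (rule that)
qed

text \<open>A tetrahedron arises from the patch consisting of \<open>xyw\<close> alone by
  \<open>extend\<close> with new vertex \<open>z\<close>, the removed face being
  \<open>xyz\<close>.\<close>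

lemma face_type_tetrahedron:
  assumes T: "tetrahedron T" and F: "F \<in> T"
  shows "face_type T F 0"
proof -
  have "card F = 3" using tetrahedronD(2)[OF T F] .
  then obtain x y z where F': "F = {x, y, z}" by (auto simp: card_3_iff)
  with F obtain w where w: "w \<notin> {x, y, z}" "T = {{x, y, z}, {x, y, w}, {y, z, w}, {z, x, w}}"
    "card {x, y, z} = 3"
    using tetrahedron_faces[OF T] by metis
  then have "card {x, y, w} = 3" unfolding card_3_distinct by auto
  from patch_face[OF this] obtain lab where lab: "patch {{x, y, w}} x y w [4, 5, 3, 2, 0, 1] lab"
    by blast
  have "z \<notin> \<Union>{{x, y, w}}" using w(1,3) unfolding card_3_distinct by auto
  moreover have "[4, 5, 3, 2, 0, 1] \<in> set matchings" "matching_type (extend [4, 5, 3, 2, 0, 1]) = 0"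
    by code_simp+
  ultimately have "face_type ({{x, y, w}} \<union> {{x, y, z}, {y, w, z}, {w, x, z}}) {x, y, z} 0"
    using face_type_extend[OF lab] by metis
  moreover have "{{x, y, w}} \<union> {{x, y, z}, {y, w, z}, {w, x, z}} = T"
    unfolding w(2) by (auto simp: insert_commute)
  ultimately show ?thesis using F' by simp
qed

text \<open>After the renaming of vertices, each new face is the one removed by
  \<open>extend\<close> for one of the three rotations of the boundary.\<close>

lemma face_type_connected_sum:
  assumes F: "face_type \<Theta> F t" and glue: "tetrahedron_gluing \<Theta> F (T, F', g)"
  obtains G1 G2 G3 t1 t2 t3 where
    "T - {F'} = {G1, G2, G3}" "G1 \<noteq> G2" "G2 \<noteq> G3" "G1 \<noteq> G3"
    "face_type (connected_sum \<Theta> F g T F') G1 t1" "face_type (connected_sum \<Theta> F g T F') G2 t2"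
    "face_type (connected_sum \<Theta> F g T F') G3 t3" "sort [t1, t2, t3] = next_types t"
proof -
  obtain a b c M lab where *: "F \<in> \<Theta>" "F = {a, b, c}" "patch (\<Theta> - {F}) a b c M lab"
    "M \<in> set matchings" "t = matching_type M"
    using F unfolding face_type_def by blast
  interpret patch "\<Theta> - {F}" a b c M lab by fact
  have T: "tetrahedron T" "\<Union>\<Theta> \<inter> \<Union>T = {}" "F' \<in> T" "bij_betw g F F'"
    using glue by (auto simp: tetrahedron_gluing_def)
  define r where "r = (\<lambda>v. if v \<in> F then g v else v)"
  have gF: "g v \<in> \<Union>T" if "v \<in> F" for v using T(3,4) that bij_betwE by blast
  \<comment> \<open>\<open>g\<close> moves \<open>F\<close> into the vertices of \<open>T\<close>,
    which are disjoint from those of \<open>\<Theta>\<close>.\<close>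
  have "inj_on r (\<Union>\<Theta>)"
  proof (rule inj_onI)
    fix x y assume xy: "x \<in> \<Union>\<Theta>" "y \<in> \<Union>\<Theta>" "r x = r y"
    then have "x \<in> F \<longleftrightarrow> y \<in> F"
      using gF T(2) unfolding r_def by (metis disjoint_iff)
    then show "x = y"
      using xy(3) T(4) unfolding r_def bij_betw_def by (metis inj_onD)
  qed
  then have "inj_on r (\<Union>(\<Theta> - {F}))" by (rule inj_on_subset) blast
  from patch_image[OF this] obtain label1 where
    1: "patch ((`) r ` (\<Theta> - {F})) (g a) (g b) (g c) M label1"
    unfolding r_def *(2) by auto
  let ?P = "(`) r ` (\<Theta> - {F})" and ?a = "g a" and ?b = "g b" and ?c = "g c"
  have F': "F' = {?a, ?b, ?c}" using T(4) *(2) by (auto simp: bij_betw_def)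
  then obtain d where d: "d \<notin> {?a, ?b, ?c}" "T = {{?a, ?b, ?c}, {?a, ?b, d}, {?b, ?c, d}, {?c, ?a, d}}"
    "card {?a, ?b, ?c} = 3"
    using tetrahedron_faces[OF T(1)] T(3) by metis
  \<comment> \<open>Only vertices of \<open>F\<close> are renamed into \<open>T\<close>, and these
    land in \<open>F'\<close>, which omits \<open>d\<close>.\<close>
  have d_P: "d \<notin> \<Union>?P"
  proof
    assume "d \<in> \<Union>?P"
    then obtain y where y: "y \<in> \<Union>\<Theta>" "d = r y" by blast
    have "d \<in> \<Union>T" unfolding d(2) by simp
    with y have "y \<in> F" using T(2) unfolding r_def by (metis disjoint_iff)
    then have "d \<in> F'" using y(2) T(4) unfolding r_def by (metis bij_betwE)
    then show False using d(1) F' by simp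
  qed
  have ne: "?a \<noteq> ?b" "?b \<noteq> ?c" "?a \<noteq> ?c" "d \<noteq> ?a" "d \<noteq> ?b" "d \<noteq> ?c"
    using d(1,3) unfolding card_3_distinct by auto
  let ?G = "?P \<union> {{?a, ?b, d}, {?b, ?c, d}, {?c, ?a, d}}"
  have TF: "T - {F'} = {{?a, ?b, d}, {?b, ?c, d}, {?c, ?a, d}}"
  proof -
    have "d \<notin> F'" using d(1) F' by simp
    then show ?thesis using d(2) F' by blast
  qed
  have sum: "connected_sum \<Theta> F g T F' = ?G"
    unfolding connected_sum_def TF r_def by simp
  interpret P1: patch ?P ?a ?b ?c M label1 by fact
  note P2 = P1.patch_rotate
  note P3 = patch.patch_rotate[OF P2]
  note R1 = extend_matching(1)[OF *(4)]
  note R2 = extend_matching(1)[OF R1]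
  have "face_type ?G {?a, ?b, d} (matching_type (extend M))"
    by (rule face_type_extend[OF 1 *(4) d_P])
  moreover have "face_type ?G {?b, ?c, d} (matching_type (extend (rot M)))"
    using face_type_extend[OF P2 R1 d_P] by (simp add: insert_commute)
  moreover have "face_type ?G {?c, ?a, d} (matching_type (extend (rot (rot M))))"
    using face_type_extend[OF P3 R2 d_P] by (simp add: insert_commute)
  moreover have "{?a, ?b, d} \<noteq> {?b, ?c, d}" "{?b, ?c, d} \<noteq> {?c, ?a, d}" "{?a, ?b, d} \<noteq> {?c, ?a, d}"
        proof -
      have "?a \<notin> {?b, ?c, d}" "?b \<notin> {?c, ?a, d}" using ne by simp_all
      then show "{?a, ?b, d} \<noteq> {?b, ?c, d}" "{?b, ?c, d} \<noteq> {?c, ?a, d}" "{?a, ?b, d} \<noteq> {?c, ?a, d}"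
        by blast+
    qed
  ultimately show thesis
    using extend_matching(3)[OF *(4)] by (intro that[OF TF]) (simp_all add: sum *(5))
qed

lemma chain_face_types:
  assumes "chain_state n \<Theta> A"
  shows "finite A \<and> A \<noteq> {} \<and> (\<forall>F\<in>A. \<exists>t. face_type \<Theta> F t)"
  using assms
proof induction
  case (start T)
  then obtain V where V: "card V = 4" "T = {F. F \<subseteq> V \<and> card F = 3}"
    by (auto simp: tetrahedron_def)
  have "3 \<le> card V" using V(1) by simp
  then obtain F where "F \<subseteq> V" "card F = 3" by (rule obtain_subset_with_card_n)
  then have "T \<noteq> {}" using V(2) by blast
  then show ?case using face_type_tetrahedron start tetrahedronD(3) by blast
next
  case (step n \<Theta> A F T F' g)
  then obtain t where "face_type \<Theta> F t" by blast
  then show ?case using step(3) by (rule face_type_connected_sum) auto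
qed

section \<open>The random construction\<close>

text \<open>The Markov operator on observables: \<open>(average ^^ m) h t\<close> is the mean of
  \<open>h\<close> after \<open>m\<close> transitions from type \<open>t\<close>.\<close>

definition average :: "(nat \<Rightarrow> real) \<Rightarrow> nat \<Rightarrow> real" where
  "average h t = sum_list (map h (next_types t)) / 3"

text \<open>
  Generalizing over the observable \<open>H\<close> makes it unnecessary to know that the type of a face is unique.
\<close>

lemma expectation_random_chain:
  fixes R :: "'a set set \<Rightarrow> 'a set \<Rightarrow> 'a set set \<times> 'a set \<times> ('a \<Rightarrow> 'a)"
  assumes R: "gluing_rule R" and T: "tetrahedron T"
    and H: "\<And>n \<Theta> A \<rho>. chain_state n \<Theta> A \<Longrightarrow> (\<And>F. F \<in> A \<Longrightarrow> face_type \<Theta> F (\<rho> F)) \<Longrightarrow>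
      H (\<Theta>, A) = (\<Sum>F\<in>A. h (\<rho> F)) / card A"
  shows "measure_pmf.expectation (random_chain R T m) H = (average ^^ m) h 0"
  using H
proof (induction m arbitrary: H h)
  case 0
  \<comment> \<open>All four initial faces have type 0, so the first choice among four needs no
    separate treatment.\<close>
  have "H (T, T) = (\<Sum>F\<in>T. h 0) / card T"
    using 0[OF chain_state.start[OF T], of "\<lambda>_. 0"] face_type_tetrahedron[OF T] by simp
  moreover have "card T \<noteq> 0" using chain_face_types[OF chain_state.start[OF T]] by auto
  ultimately show ?case by simp
next
  case (Suc m)
  let ?H = "\<lambda>s. measure_pmf.expectation (glue_random R s) H"
  let ?p = "random_chain R T m"
  have fin_glue: "finite (set_pmf (glue_random R (\<Theta>, A)))" if "chain_state n \<Theta> A" for n \<Theta> A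
    using chain_face_types[OF that] by (simp add: glue_random_def)
  have fin: "finite (set_pmf (random_chain R T k))" for k
  proof (induction k)
    case (Suc k)
    moreover have "finite (set_pmf (glue_random R s))" if "s \<in> set_pmf (random_chain R T k)" for s
      using that fin_glue random_chain_state[OF R T] by (cases s) blast
    ultimately show ?case by simp
  qed simp
  have "measure_pmf.expectation (random_chain R T (Suc m)) H = (\<Sum>s\<in>set_pmf ?p. pmf ?p s *\<^sub>R ?H s)"
    unfolding random_chain.simps
  proof (rule pmf_expectation_bind[OF fin])
    show "finite (set_pmf (glue_random R s))" if "s \<in> set_pmf ?p" for s
      using that fin_glue random_chain_state[OF R T] by (cases s) blast
  qed simp
  also have "\<dots> = measure_pmf.expectation ?p ?H"
    by (rule integral_measure_pmf[symmetric, OF fin]) simp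
  \<comment> \<open>The conditional mean one gluing ahead is again an admissible observable, with
    \<open>average h\<close> in place of \<open>h\<close>.\<close>
  also have "\<dots> = (average ^^ m) (average h) 0"
  proof (rule Suc.IH)
    fix n and \<Theta> A :: "'a set set" and \<rho>
    assume chain: "chain_state n \<Theta> A" and \<rho>: "\<And>F. F \<in> A \<Longrightarrow> face_type \<Theta> F (\<rho> F)"
    define f where "f F = (case R \<Theta> F of (T, F', g) \<Rightarrow> (connected_sum \<Theta> F g T F', T - {F'}))" for F
    have A: "finite A" "A \<noteq> {}" using chain_face_types[OF chain] by auto
    have "?H (\<Theta>, A) = (\<Sum>F\<in>A. H (f F)) / card A"
      using A by (simp add: glue_random_def integral_pmf_of_set f_def)
    also have "(\<Sum>F\<in>A. H (f F)) = (\<Sum>F\<in>A. average h (\<rho> F))"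
    proof (rule sum.cong[OF refl])
      fix F assume F: "F \<in> A"
      obtain T1 F1 g where R1: "R \<Theta> F = (T1, F1, g)" by (metis prod_cases3)
      then have glue: "tetrahedron_gluing \<Theta> F (T1, F1, g)"
        using R chain F unfolding gluing_rule_def by metis
      let ?S = "connected_sum \<Theta> F g T1 F1"
      obtain G1 G2 G3 t1 t2 t3 where G:
        "T1 - {F1} = {G1, G2, G3}" "G1 \<noteq> G2" "G2 \<noteq> G3" "G1 \<noteq> G3"
        "face_type ?S G1 t1" "face_type ?S G2 t2" "face_type ?S G3 t3"
        "sort [t1, t2, t3] = next_types (\<rho> F)"
        by (rule face_type_connected_sum[OF \<rho>[OF F] glue])
      define \<rho>' where "\<rho>' G = (if G = G1 then t1 else if G = G2 then t2 else t3)" for G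
      have "f F = (?S, {G1, G2, G3})" using R1 G(1) by (simp add: f_def)
      also have "H \<dots> = (\<Sum>G\<in>{G1, G2, G3}. h (\<rho>' G)) / card {G1, G2, G3}"
      proof (rule Suc.prems)
        show "chain_state (n + 1) ?S {G1, G2, G3}"
          using chain_state.step[OF chain F glue] G(1) by simp
        show "face_type ?S G (\<rho>' G)" if "G \<in> {G1, G2, G3}" for G
          using that G by (auto simp: \<rho>'_def)
      qed
      also have "\<dots> = (h t1 + h t2 + h t3) / 3" using G(2-4) by (simp add: \<rho>'_def)
      also have "h t1 + h t2 + h t3 = sum_list (map h [t1, t2, t3])" by simp
      also have "\<dots> = sum_list (map h (sort [t1, t2, t3]))"
        unfolding sum_mset_sum_list[symmetric] mset_map mset_sort ..
      also have "\<dots> / 3 = average h (\<rho> F)" unfolding G(8) average_def ..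
      finally show "H (f F) = average h (\<rho> F)" .
    qed
    finally show "?H (\<Theta>, A) = (\<Sum>F\<in>A. average h (\<rho> F)) / card A" .
  qed
  also have "\<dots> = (average ^^ Suc m) h 0" by (simp add: funpow_swap1)
  finally show ?case .
qed

text \<open>All faces in \<open>A\<close> yield the same zigzag count, so averaging its indicator
  over \<open>A\<close> changes nothing.\<close>

lemma zigzag_prob_eq:
  fixes R :: "'a set set \<Rightarrow> 'a set \<Rightarrow> 'a set set \<times> 'a set \<times> ('a \<Rightarrow> 'a)"
  assumes R: "gluing_rule R" and T: "tetrahedron T"
  shows "zigzag_prob R T k n = (average ^^ (n - 1)) (\<lambda>t. of_bool (type_zigzags t = k)) 0"
proof -
  let ?S = "{(\<Theta>, A). has_zigzags_up_to_reversing \<Theta> k} :: ('a set set \<times> 'a set set) set"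
  have "zigzag_prob R T k n = measure_pmf.expectation (random_chain R T (n - 1)) (indicator ?S)"
    by (simp add: zigzag_prob_def)
  also have "\<dots> = (average ^^ (n - 1)) (\<lambda>t. of_bool (type_zigzags t = k)) 0"
  proof (rule expectation_random_chain[OF R T])
    fix m and \<Theta> A :: "'a set set" and \<rho>
    assume "chain_state m \<Theta> A" and \<rho>: "\<And>F. F \<in> A \<Longrightarrow> face_type \<Theta> F (\<rho> F)"
    then have A: "finite A" "A \<noteq> {}" using chain_face_types by blast+
    have "(\<Sum>F\<in>A. of_bool (type_zigzags (\<rho> F) = k)) =
        (\<Sum>F\<in>A. of_bool (has_zigzags_up_to_reversing \<Theta> k) :: real)"
      using face_type_zigzags[OF \<rho>] by (intro sum.cong) auto
    then show "indicator ?S (\<Theta>, A) = (\<Sum>F\<in>A. of_bool (type_zigzags (\<rho> F) = k)) / real (card A)"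
      using A by (simp add: indicator_def)
  qed
  finally show ?thesis .
qed

section \<open>Convergence to the stationary distribution\<close>

lemma average_simps:
  "average h 0 = h 1" "average h (Suc 0) = (h 2 + 2 * h 4) / 3" "average h 2 = (2 * h 3 + h 6) / 3"
  "average h 3 = (2 * h 1 + h 5) / 3" "average h 4 = (2 * h 2 + h 4) / 3" "average h 5 = h 3"
  "average h 6 = h 0"
  by (simp_all add: average_def next_types_def)

text \<open>The weights are the sizes of the seven classes of matchings.\<close>

definition stationary_mean :: "(nat \<Rightarrow> real) \<Rightarrow> real" where
  "stationary_mean h = (h 0 + 3 * h 1 + 3 * h 2 + 3 * h 3 + 3 * h 4 + h 5 + h 6) / 15"

text \<open>\<open>extend\<close> and \<open>rot\<close> conjugate by permutations, so the uniform
  distribution on the fifteen matchings is stationary, and with it the class sizes; on types this is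
  a comparison of coefficients.\<close>

lemma stationary_mean_average: "stationary_mean (average h) = stationary_mean h"
  by (simp add: stationary_mean_def average_simps field_simps)

definition bounds :: "real \<Rightarrow> real \<Rightarrow> (nat \<Rightarrow> real) \<Rightarrow> bool" where
  "bounds l u h \<longleftrightarrow> (\<forall>t\<in>{0, 1, 2, 3, 4, 5, 6}. l \<le> h t \<and> h t \<le> u)"

lemma bounds_average: "bounds l u h \<Longrightarrow> bounds l u (average h)"
  unfolding bounds_def by (simp add: average_simps)

text \<open>From every type, type 4 is reached in exactly three steps with probability at least 1/27.\<close>

lemma bounds_average3:
  assumes "bounds l u h"
  shows "bounds (l + (h 4 - l) / 27) (u - (u - h 4) / 27) (average (average (average h)))"
  using assms unfolding bounds_def by (simp add: average_simps field_simps)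

text \<open>Three transitions shrink the enclosing interval by the factor 26/27, since both ends
  move towards the common value \<open>h 4\<close>.\<close>

lemma bounds_average_funpow:
  assumes "bounds 0 1 h"
  shows "\<exists>l u. bounds l u ((average ^^ m) h) \<and> u - l \<le> 2 * (99 / 100) ^ m"
proof (induction m rule: less_induct)
  case (less m)
  show ?case
  proof (cases "m < 3")
    case True
    have "bounds 0 1 ((average ^^ m) h)" by (induction m) (use assms bounds_average in auto)
    moreover have "m = 0 \<or> m = 1 \<or> m = 2" using True by auto
    \<comment> \<open>The factor 2 covers the start: \<open>2 * (99 / 100) ^ 2\<close> still exceeds
      1.\<close>
    then have "(1 :: real) - 0 \<le> 2 * (99 / 100) ^ m" by (auto simp: power2_eq_square)
    ultimately show ?thesis by blast
  next
    case False
    then have k: "m = Suc (Suc (Suc (m - 3)))" by simp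
    then obtain k where k: "m = Suc (Suc (Suc k))" by blast
    then obtain l u where lu: "bounds l u ((average ^^ k) h)" "u - l \<le> 2 * (99 / 100) ^ k"
      using less.IH[of k] by auto
    let ?v = "(average ^^ k) h 4"
    have "(u - (u - ?v) / 27) - (l + (?v - l) / 27) = 26 / 27 * (u - l)" by (simp add: field_simps)
    also have "\<dots> \<le> 26 / 27 * (2 * (99 / 100) ^ k)" using lu(2) by (intro mult_left_mono) auto
    \<comment> \<open>The rate 99/100 is chosen so that its cube is at least 26/27.\<close>
    also have "\<dots> \<le> 2 * (99 / 100) ^ m" unfolding k by simp
    finally have "(u - (u - ?v) / 27) - (l + (?v - l) / 27) \<le> 2 * (99 / 100) ^ m" .
    moreover have "bounds (l + (?v - l) / 27) (u - (u - ?v) / 27) ((average ^^ m) h)"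
      using bounds_average3[OF lu(1)] unfolding k by simp
    ultimately show ?thesis by blast
  qed
qed

text \<open>The stationary mean is invariant under \<open>average\<close> and is a convex
  combination of the seven values, so it lies in the same interval as the value at 0.\<close>

lemma average_funpow_limit:
  assumes "bounds 0 1 h"
  shows "\<bar>(average ^^ m) h 0 - stationary_mean h\<bar> \<le> 2 * (99 / 100) ^ m"
proof -
  obtain l u where lu: "bounds l u ((average ^^ m) h)" "u - l \<le> 2 * (99 / 100) ^ m"
    using bounds_average_funpow[OF assms] by blast
  have "stationary_mean ((average ^^ m) h) = stationary_mean h"
    by (induction m) (simp_all add: stationary_mean_average)
  moreover have "l \<le> stationary_mean ((average ^^ m) h)" "stationary_mean ((average ^^ m) h) \<le> u"
    using lu(1) by (simp_all add: bounds_def stationary_mean_def)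
  moreover have "l \<le> (average ^^ m) h 0" "(average ^^ m) h 0 \<le> u" using lu(1) by (auto simp: bounds_def)
  ultimately show ?thesis using lu(2) by linarith
qed

theorem theorem1:
  shows "(\<forall>n (\<Theta> :: 'a set set). tetrahedral_chain n \<Theta> \<longrightarrow>
            (\<exists>k\<le>3. has_zigzags_up_to_reversing \<Theta> k)) \<and>
         (\<forall>(R :: 'a set set \<Rightarrow> 'a set \<Rightarrow> 'a set set \<times> 'a set \<times> ('a \<Rightarrow> 'a)) T.
            gluing_rule R \<and> tetrahedron T \<longrightarrow>
              zigzag_prob R T 1 \<longlonglongrightarrow> 8 / 15 \<and>
              zigzag_prob R T 2 \<longlonglongrightarrow> 2 / 5 \<and>
              zigzag_prob R T 3 \<longlonglongrightarrow> 1 / 15 \<and>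
              (\<forall>(k, L) \<in> {(1, 8 / 15), (2, 2 / 5), (3, 1 / 15)}.
                 \<exists>c>0. \<exists>\<gamma>. 0 < \<gamma> \<and> \<gamma> < 1 \<and>
                   (\<forall>n\<ge>1. \<bar>zigzag_prob R T k n - L\<bar> \<le> c * \<gamma> ^ n)))"
proof (intro conjI allI impI)
  fix n and \<Theta> :: "'a set set"
  assume "tetrahedral_chain n \<Theta>"
  then obtain A where "chain_state n \<Theta> A" unfolding tetrahedral_chain_def by blast
  from chain_face_types[OF this] obtain F t where F: "face_type \<Theta> F t" by blast
  have "t \<in> {0, 1, 2, 3, 4, 5, 6}" using face_type_less[OF F] by auto
  then have "type_zigzags t \<le> 3" by (auto simp: type_zigzags_def)
  then show "\<exists>k\<le>3. has_zigzags_up_to_reversing \<Theta> k" using face_type_zigzags[OF F] by blast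
next
  fix R :: "'a set set \<Rightarrow> 'a set \<Rightarrow> 'a set set \<times> 'a set \<times> ('a \<Rightarrow> 'a)" and T :: "'a set set"
  assume "gluing_rule R \<and> tetrahedron T"
  then have RT: "gluing_rule R" "tetrahedron T" by auto
  define L where "L k = stationary_mean (\<lambda>t. of_bool (type_zigzags t = k))" for k
  have L: "L 1 = 8 / 15" "L 2 = 2 / 5" "L 3 = 1 / 15"
    by (simp_all add: L_def stationary_mean_def type_zigzags_def)
  have bound: "\<bar>zigzag_prob R T k n - L k\<bar> \<le> 200 / 99 * (99 / 100) ^ n" if "n \<ge> 1" for k n
  proof -
    have "\<bar>zigzag_prob R T k n - L k\<bar> \<le> 2 * (99 / 100) ^ (n - 1)"
      unfolding zigzag_prob_eq[OF RT] L_def by (rule average_funpow_limit) (simp add: bounds_def)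
    \<comment> \<open>Passing from \<open>n - 1\<close> gluings to \<open>n\<close> tetrahedra costs
      the factor 100/99.\<close>
    also have "\<dots> = 200 / 99 * (99 / 100) ^ n"
      using that by (cases n) simp_all
    finally show ?thesis .
  qed
  have lim: "zigzag_prob R T k \<longlonglongrightarrow> L k" for k
  proof (rule LIM_zero_cancel, rule Lim_null_comparison)
    show "\<forall>\<^sub>F n in sequentially. norm (zigzag_prob R T k n - L k) \<le> 200 / 99 * (99 / 100) ^ n"
      using eventually_ge_at_top[of 1] by eventually_elim (use bound in simp)
    show "(\<lambda>n. 200 / 99 * (99 / 100) ^ n :: real) \<longlonglongrightarrow> 0"
      by (intro tendsto_mult_right_zero LIMSEQ_realpow_zero) auto
  qed
  show "zigzag_prob R T 1 \<longlonglongrightarrow> 8 / 15" "zigzag_prob R T 2 \<longlonglongrightarrow> 2 / 5" "zigzag_prob R T 3 \<longlonglongrightarrow> 1 / 15"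
    using lim[of 1] lim[of 2] lim[of 3] unfolding L by auto
  have ex: "\<exists>c>0. \<exists>\<gamma>. 0 < \<gamma> \<and> \<gamma> < 1 \<and> (\<forall>n\<ge>1. \<bar>zigzag_prob R T k n - L k\<bar> \<le> c * \<gamma> ^ n)" for k
    by (rule exI[of _ "200 / 99"], simp, rule exI[of _ "99 / 100"]) (use bound in simp)
  show "\<forall>(k, L) \<in> {(1, 8 / 15), (2, 2 / 5), (3, 1 / 15)}.
                 \<exists>c>0. \<exists>\<gamma>. 0 < \<gamma> \<and> \<gamma> < 1 \<and>
                   (\<forall>n\<ge>1. \<bar>zigzag_prob R T k n - L\<bar> \<le> c * \<gamma> ^ n)"
    using ex[of 1] ex[of 2] ex[of 3] unfolding L by blast
qed

end
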